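(* Let $f:\mathbb{R}^n\to\mathbb{R}$ be convex and continuously differentiable, let $R>0$, and consider the problem $\min_{\mathbf{x}\in\mathbb{R}^n:\ \|\mathbf{x}\|_1\le R}f(\mathbf{x})$. Let $\beta_1$ be the Lipschitz constant of $\nabla f$ w.r.t. the $\ell_1$ norm and let $\alpha_2>0$ be the $\ell_2$-quadratic growth constant (both defined in the context). Suppose that for any optimal solution $\mathbf{x}^*$ it holds that $\mathrm{nnz}(\mathbf{x}^* )\le s$ and $\|\mathbf{x}^*\|_1=R$. Then the away-steps Frank-Wolfe algorithm (described in the context) finds an $\epsilon$-approximated solution (in function value) after at most $O\left(\frac{\beta_1 sR^2}{\alpha_2}\log\frac{\beta_1R^2}{\epsilon}\right)$ iterations. In particular, when $f(\mathbf{x})=\frac12\mathbf{x}^\top\mathbf{A}\mathbf{x}+\mathbf{b}^\top\mathbf{x}$ with $\mathbf{A}\succeq 0$, the overall runtime is $O\left(\frac{ns\beta_1R^2}{\alpha_2}\log\frac{\beta_1R^2}{\epsilon}\right)$.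
   Context: $\mathrm{nnz}(\mathbf{x})$ is the number of non-zero entries of $\mathbf{x}$. $\mathcal{K}=\{\mathbf{x}\in\mathbb{R}^n:\|\mathbf{x}\|_1\le R\}$, $f^*$ is the optimal value, $\mathcal{X}^*$ is the set of minimizers over $\mathcal{K}$. The constant $\beta_1>0$ satisfies $\|\nabla f(\mathbf{x})-\nabla f(\mathbf{y})\|_\infty\le\beta_1\|\mathbf{x}-\mathbf{y}\|_1$ for all $\mathbf{x},\mathbf{y}$. The constant $\alpha_2>0$ satisfies $\min_{\mathbf{x}^*\in\mathcal{X}^*}\|\mathbf{x}-\mathbf{x}^*\|_2^2\le\frac{2}{\alpha_2}(f(\mathbf{x})-f^* )$ for all $\mathbf{x}\in\mathcal{K}$. A feasible $\mathbf{x}$ is an $\epsilon$-approximated solution (in function value) if $f(\mathbf{x})-f^*\le\epsilon$. $O(\cdot)$ hides universal constants; runtime counts arithmetic operations on real numbers. Away-steps Frank-Wolfe algorithm with line-search (Guélat-Marcotte; Lacoste-Julien and Jaggi) on $\mathcal{K}$. Let $\mathcal{A}=\{\pm R\mathbf{e}_i: i=1,\dots,n\}$ be the vertices of $\mathcal{K}$. Start at $\mathbf{x}^{(0)}\in\mathcal{A}$ with active set $S^{(0)}=\{\mathbf{x}^{(0)}\}$ and weight $1$ on $\mathbf{x}^{(0)}$. At iteration $t$, $\mathbf{x}^{(t)}=\sum_{\mathbf{v}\in S^{(t)}}\lambda^{(t)}_{\mathbf{v}}\mathbf{v}$ is a convex combination with positive weights. Choose $\mathbf{u}_t\in\arg\min_{\mathbf{u}\in\mathcal{A}}\langle\nabla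 f(\mathbf{x}^{(t)}),\mathbf{u}\rangle$ and set $\mathbf{d}^{FW}_t=\mathbf{u}_t-\mathbf{x}^{(t)}$; choose $\mathbf{w}_t\in\arg\max_{\mathbf{w}\in S^{(t)}}\langle\nabla f(\mathbf{x}^{(t)}),\mathbf{w}\rangle$ and set $\mathbf{d}^{A}_t=\mathbf{x}^{(t)}-\mathbf{w}_t$. Stop if $\langle-\nabla f(\mathbf{x}^{(t)}),\mathbf{d}^{FW}_t\rangle\le\epsilon$. If $\langle-\nabla f(\mathbf{x}^{(t)}),\mathbf{d}^{FW}_t\rangle\ge\langle-\nabla f(\mathbf{x}^{(t)}),\mathbf{d}^{A}_t\rangle$, let $\mathbf{d}_t=\mathbf{d}^{FW}_t$ and $\gamma_{\max}=1$; otherwise let $\mathbf{d}_t=\mathbf{d}^{A}_t$ and $\gamma_{\max}=\lambda^{(t)}_{\mathbf{w}_t}/(1-\lambda^{(t)}_{\mathbf{w}_t})$. Choose $\gamma_t\in\arg\min_{\gamma\in[0,\gamma_{\max}]}f(\mathbf{x}^{(t)}+\gamma\mathbf{d}_t)$, set $\mathbf{x}^{(t+1)}=\mathbf{x}^{(t)}+\gamma_t\mathbf{d}_t$, and update the weights: for a Frank-Wolfe step, multiply all weights by $1-\gamma_t$ and add $\gamma_t$ to the weight of $\mathbf{u}_t$; for an away step, multiply all weights by $1+\gamma_t$ and subtract $\gamma_t$ from the weight of $\mathbf{w}_t$. $S^{(t+1)}$ is the set of vertices with positive weight.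
   Formalization: The factor R² outside the logarithm is replaced by max(1, R²), and each O(X) bound is read with X replaced by max(1, X) (runtime: n·max(1, X)); as written the bound fails for small R, e.g. f(x)=½|x/R−𝟙/n|², where at least n−1 iterations are needed. *)

theory Defs
  imports "HOL-Analysis.Analysis" "HOL-Library.Monad_Syntax" "HOL-Library.While_Combinator"
begin

section \<open>The optimization problem\<close>

definition l1norm :: "real^'n \<Rightarrow> real" where
  "l1norm x = (\<Sum>i\<in>UNIV. \<bar>x $ i\<bar>)"

definition nnz :: "real^'n \<Rightarrow> nat" where
  "nnz x = card {i. x $ i \<noteq> 0}"

definition l1ball :: "real \<Rightarrow> (real^'n) set" where
  "l1ball R = {x. l1norm x \<le> R}"

definition opt_value :: "(real^'n \<Rightarrow> real) \<Rightarrow> real \<Rightarrow> real" where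
  "opt_value f R = (INF x\<in>l1ball R. f x)"

definition minimizers :: "(real^'n \<Rightarrow> real) \<Rightarrow> real \<Rightarrow> (real^'n) set" where
  "minimizers f R = {x \<in> l1ball R. \<forall>y\<in>l1ball R. f x \<le> f y}"

definition approx_solution :: "(real^'n \<Rightarrow> real) \<Rightarrow> real \<Rightarrow> real \<Rightarrow> real^'n \<Rightarrow> bool" where
  "approx_solution f R \<epsilon> x \<longleftrightarrow> x \<in> l1ball R \<and> f x - opt_value f R \<le> \<epsilon>"

text \<open>The infimum below is a minimum: for continuous \<open>f\<close> and \<open>R \<ge> 0\<close> the set of minimizers
  is compact and nonempty.\<close>

definition quadratic_growth :: "(real^'n \<Rightarrow> real) \<Rightarrow> real \<Rightarrow> real \<Rightarrow> bool" where
  "quadratic_growth f R \<alpha> \<longleftrightarrow>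
     (\<forall>x\<in>l1ball R. (INF y\<in>minimizers f R. (norm (x - y))\<^sup>2) \<le> 2 / \<alpha> * (f x - opt_value f R))"


section \<open>Away-steps Frank-Wolfe with line-search\<close>

text \<open>The pair \<open>(True, i)\<close> stands for the vertex \<open>R e\<^sub>i\<close> and \<open>(False, i)\<close> for \<open>- R e\<^sub>i\<close>.\<close>

definition vertex :: "real \<Rightarrow> bool \<times> 'n \<Rightarrow> real^'n" where
  "vertex R k = (if fst k then R else - R) *\<^sub>R axis (snd k) 1"

definition vertices :: "real \<Rightarrow> (real^'n) set" where
  "vertices R = range (vertex R)"

text \<open>A state consists of the current point and the weights of the vertices; the active set is
  the set of vertices of positive weight.\<close>

type_synonym 'n afw_state = "(real^'n) \<times> (real^'n \<Rightarrow> real)"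

definition active :: "real \<Rightarrow> (real^'n \<Rightarrow> real) \<Rightarrow> (real^'n) set" where
  "active R wt = {v \<in> vertices R. 0 < wt v}"

definition lmo :: "(real^'n \<Rightarrow> real^'n) \<Rightarrow> real \<Rightarrow> real^'n \<Rightarrow> real^'n \<Rightarrow> bool" where
  "lmo df R x u \<longleftrightarrow> is_arg_min (\<lambda>v. df x \<bullet> v) (\<lambda>v. v \<in> vertices R) u"

definition away_vertex ::
  "(real^'n \<Rightarrow> real^'n) \<Rightarrow> real \<Rightarrow> 'n afw_state \<Rightarrow> real^'n \<Rightarrow> bool" where
  "away_vertex df R st w \<longleftrightarrow>
     is_arg_max (\<lambda>v. df (fst st) \<bullet> v) (\<lambda>v. v \<in> active R (snd st)) w"

definition line_search ::
  "(real^'n \<Rightarrow> real) \<Rightarrow> real^'n \<Rightarrow> real^'n \<Rightarrow> real \<Rightarrow> real \<Rightarrow> bool" where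
  "line_search f x d \<gamma>max \<gamma> \<longleftrightarrow> is_arg_min (\<lambda>c. f (x + c *\<^sub>R d)) (\<lambda>c. c \<in> {0..\<gamma>max}) \<gamma>"

text \<open>The stopping test does not depend on how ties between minimizing vertices are broken.\<close>

definition afw_stop :: "(real^'n \<Rightarrow> real^'n) \<Rightarrow> real \<Rightarrow> real \<Rightarrow> 'n afw_state \<Rightarrow> bool" where
  "afw_stop df R \<epsilon> st \<longleftrightarrow>
     (\<exists>u. lmo df R (fst st) u \<and> (- df (fst st)) \<bullet> (u - fst st) \<le> \<epsilon>)"

definition afw_step ::
  "(real^'n \<Rightarrow> real) \<Rightarrow> (real^'n \<Rightarrow> real^'n) \<Rightarrow> real \<Rightarrow> 'n afw_state \<Rightarrow> 'n afw_state \<Rightarrow> bool" where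
  "afw_step f df R st st' \<longleftrightarrow>
     (\<exists>u w \<gamma>. lmo df R (fst st) u \<and> away_vertex df R st w \<and>
       (let x = fst st; wt = snd st; dFW = u - x; dA = x - w in
        if (- df x) \<bullet> dA \<le> (- df x) \<bullet> dFW
        then line_search f x dFW 1 \<gamma> \<and>
             st' = (x + \<gamma> *\<^sub>R dFW, \<lambda>v. (1 - \<gamma>) * wt v + (if v = u then \<gamma> else 0))
        else line_search f x dA (wt w / (1 - wt w)) \<gamma> \<and>
             st' = (x + \<gamma> *\<^sub>R dA, \<lambda>v. (1 + \<gamma>) * wt v - (if v = w then \<gamma> else 0))))"

text \<open>A run is a sequence of states in which the state is repeated forever once the stopping
  test has succeeded.  All ties are broken arbitrarily.\<close>

definition afw_run ::
  "(real^'n \<Rightarrow> real) \<Rightarrow> (real^'n \<Rightarrow> real^'n) \<Rightarrow> real \<Rightarrow> real \<Rightarrow> (nat \<Rightarrow> 'n afw_state) \<Rightarrow> bool" where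
  "afw_run f df R \<epsilon> \<sigma> \<longleftrightarrow>
     (\<exists>v\<in>vertices R. \<sigma> 0 = (v, \<lambda>v'. if v' = v then 1 else 0)) \<and>
     (\<forall>t. if afw_stop df R \<epsilon> (\<sigma> t) then \<sigma> (Suc t) = \<sigma> t
          else afw_step f df R (\<sigma> t) (\<sigma> (Suc t)))"


section \<open>Counting arithmetic operations\<close>

text \<open>A counted value carries the number of arithmetic operations and comparisons on reals
  spent on computing it.  In the programs below every such operation is an argument of
  \<open>flop\<close>; reading or writing an entry of a vector or matrix is free.\<close>

type_synonym 'a counted = "'a \<times> nat"

definition creturn :: "'a \<Rightarrow> 'a counted" where
  "creturn a = (a, 0)"

definition flop :: "'a \<Rightarrow> 'a counted" where
  "flop a = (a, 1)"

definition cbind :: "'a counted \<Rightarrow> ('a \<Rightarrow> 'b counted) \<Rightarrow> 'b counted" where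
  "cbind m k = (fst (k (fst m)), snd m + snd (k (fst m)))"

adhoc_overloading Monad_Syntax.bind \<rightleftharpoons> cbind

text \<open>Loops over indices: \<open>cvec\<close> computes a vector entry by entry, \<open>csum\<close> spends one
  addition per summand, and the remaining three spend one comparison per examined entry.\<close>

definition cvec :: "('i::finite \<Rightarrow> real counted) \<Rightarrow> (real^'i) counted" where
  "cvec F = (\<chi> i. fst (F i), \<Sum>i\<in>UNIV. snd (F i))"

definition csum :: "('i::finite \<Rightarrow> real counted) \<Rightarrow> real counted" where
  "csum F = (\<Sum>i\<in>UNIV. fst (F i), (\<Sum>i\<in>UNIV. snd (F i)) + CARD('i))"

definition cpositive :: "real^'i \<Rightarrow> 'i set counted" where
  "cpositive v = ({i. 0 < v $ i}, CARD('i))"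

definition cargmin :: "real^'i \<Rightarrow> 'i set \<Rightarrow> 'i counted" where
  "cargmin v I = (arg_min (($) v) (\<lambda>i. i \<in> I), card I)"

definition cargmax :: "real^'i \<Rightarrow> 'i set \<Rightarrow> 'i counted" where
  "cargmax v I = (arg_max (($) v) (\<lambda>i. i \<in> I), card I)"

definition cinner :: "real^'n \<Rightarrow> real^'n \<Rightarrow> real counted" where
  "cinner x y = csum (\<lambda>i. flop (x $ i * y $ i))"


section \<open>The algorithm for a quadratic objective\<close>

text \<open>For \<open>f x = 1/2 x\<^sup>T A x + b\<^sup>T x\<close> the program state consists of the current point, the
  weights of the vertices, and the gradient \<open>A x + b\<close>.  The gradient is updated with a single
  column of \<open>A\<close> per iteration, and the line-search has a closed form.\<close>

type_synonym 'n quad_state = "(real^'n) \<times> (real^(bool \<times> 'n)) \<times> (real^'n)"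

definition csigned :: "real \<Rightarrow> bool \<Rightarrow> real counted" where
  "csigned r s = (if s then creturn r else flop (- r))"

definition quad_init ::
  "real^'n^'n \<Rightarrow> real^'n \<Rightarrow> real \<Rightarrow> bool \<times> 'n \<Rightarrow> ('n quad_state \<times> bool) counted" where
  "quad_init A b R k = do {
     r \<leftarrow> csigned R (fst k);
     g \<leftarrow> cvec (\<lambda>i. do { y \<leftarrow> flop (r * A $ i $ snd k); flop (y + b $ i) });
     creturn ((\<chi> i. if i = snd k then r else 0, \<chi> l. if l = k then 1 else 0, g), False)
   }"

text \<open>The Boolean in the result says whether the stopping test succeeded.\<close>

definition quad_iter ::
  "real^'n^'n \<Rightarrow> real^'n \<Rightarrow> real \<Rightarrow> real \<Rightarrow> 'n quad_state \<Rightarrow> ('n quad_state \<times> bool) counted" where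
  "quad_iter A b R \<epsilon> = (\<lambda>(x, wt, g). do {
     key \<leftarrow> cvec (\<lambda>k. csigned (g $ snd k) (fst k));
     u \<leftarrow> cargmin key UNIV;
     S \<leftarrow> cpositive wt;
     w \<leftarrow> cargmax key S;
     gx \<leftarrow> cinner g x;
     gu \<leftarrow> flop (R * key $ u);
     gw \<leftarrow> flop (R * key $ w);
     gapFW \<leftarrow> flop (gx - gu);
     gapA \<leftarrow> flop (gw - gx);
     stop \<leftarrow> flop (gapFW \<le> \<epsilon>);
     if stop then creturn ((x, wt, g), True)
     else do {
       Ax \<leftarrow> cvec (\<lambda>i. flop (g $ i - b $ i));
       fw \<leftarrow> flop (gapA \<le> gapFW);
       let k = (if fw then u else w);
       let gap = (if fw then gapFW else gapA);
       r \<leftarrow> csigned R (fst k);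
       let v = (\<chi> i. if i = snd k then r else 0);
       Av \<leftarrow> cvec (\<lambda>i. flop (r * A $ i $ snd k));
       d \<leftarrow> cvec (\<lambda>i. flop (if fw then v $ i - x $ i else x $ i - v $ i));
       Ad \<leftarrow> cvec (\<lambda>i. flop (if fw then Av $ i - Ax $ i else Ax $ i - Av $ i));
       \<gamma>max \<leftarrow> (if fw then creturn 1 else do { c \<leftarrow> flop (1 - wt $ w); flop (wt $ w / c) });
       dAd \<leftarrow> cinner d Ad;
       curved \<leftarrow> flop (0 < dAd);
       \<gamma> \<leftarrow> (if curved then do {
               c \<leftarrow> flop (gap / dAd);
               small \<leftarrow> flop (c \<le> \<gamma>max);
               creturn (if small then c else \<gamma>max)
             }
             else creturn \<gamma>max);
       x' \<leftarrow> cvec (\<lambda>i. do { y \<leftarrow> flop (\<gamma> * d $ i); flop (x $ i + y) });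
       g' \<leftarrow> cvec (\<lambda>i. do { y \<leftarrow> flop (\<gamma> * Ad $ i); flop (g $ i + y) });
       scale \<leftarrow> flop (if fw then 1 - \<gamma> else 1 + \<gamma>);
       scaled \<leftarrow> cvec (\<lambda>l. flop (scale * wt $ l));
       new \<leftarrow> flop (if fw then scaled $ k + \<gamma> else scaled $ k - \<gamma>);
       creturn ((x', \<chi> l. if l = k then new else scaled $ l, g'), False)
     }
   })"

definition quad_loop_body ::
  "real^'n^'n \<Rightarrow> real^'n \<Rightarrow> real \<Rightarrow> real \<Rightarrow> ('n quad_state \<times> bool) counted
     \<Rightarrow> ('n quad_state \<times> bool) counted" where
  "quad_loop_body A b R \<epsilon> m = do { (st, _) \<leftarrow> m; quad_iter A b R \<epsilon> st }"

text \<open>The whole program; the result is \<open>None\<close> if it does not terminate.\<close>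

definition quad_afw ::
  "real^'n^'n \<Rightarrow> real^'n \<Rightarrow> real \<Rightarrow> real \<Rightarrow> bool \<times> 'n \<Rightarrow> ('n quad_state \<times> bool) counted option" where
  "quad_afw A b R \<epsilon> k =
     while_option (\<lambda>((_, stopped), _). \<not> stopped) (quad_loop_body A b R \<epsilon>) (quad_init A b R k)"

text \<open>The states of the program, as states of the abstract algorithm.\<close>

definition abstract_state :: "real \<Rightarrow> 'n::finite quad_state \<Rightarrow> 'n afw_state" where
  "abstract_state R = (\<lambda>(x, wt, g :: real^'n). (x, \<lambda>v. \<Sum>k\<in>UNIV. if v = vertex R k then wt $ k else 0))"

definition quad_trace ::
  "real^'n^'n \<Rightarrow> real^'n \<Rightarrow> real \<Rightarrow> real \<Rightarrow> bool \<times> 'n \<Rightarrow> nat \<Rightarrow> 'n::finite afw_state" where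
  "quad_trace A b R \<epsilon> k t =
     abstract_state R (fst (fst ((quad_loop_body A b R \<epsilon> ^^ t) (quad_init A b R k))))"

end

theory Submission
  imports Defs
begin

text \<open>Write \<open>x = \<Sum>\<^sub>v \<lambda>\<^sub>v v\<close> for the current iterate and let \<open>z\<close> be the nearest minimizer.  Since
  \<open>\<parallel>z\<parallel>\<^sub>1 = R\<close>, the decomposition of \<open>z\<close> into vertices has weights \<open>\<bar>z\<^sub>i\<bar> / R\<close> on its at most \<open>s\<close> support
  coordinates, and turning \<open>x\<close> into \<open>z\<close> moves mass at most \<open>\<Sum>\<^bsub>i \<in> supp z\<^esub> \<bar>x\<^sub>i - z\<^sub>i\<bar> / R\<close>, which is at most
  \<open>sqrt s * norm (x - z) / R\<close>.  With convexity and quadratic growth this bounds the suboptimality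
  \<open>h\<close> by \<open>8 s g\<^sup>2 / (\<alpha> R\<^sup>2)\<close>, where \<open>g\<close> is the larger of the Frank-Wolfe gap and the away gap.  Every step
  that does not drop a vertex decreases \<open>h\<close> by at least \<open>g\<^sup>2 / (8 \<beta> R\<^sup>2)\<close>, hence by the factor
  \<open>1 - \<alpha> / (64 s \<beta>)\<close>, and at most half of the steps drop a vertex.

  The first step is a Frank-Wolfe step and brings \<open>h\<close> below \<open>2 \<beta> R\<^sup>2\<close>, whatever the starting value
  was.  As long as the stopping test fails, \<open>h > \<epsilon>\<^sup>2 / (8 \<beta> R\<^sup>2)\<close>, so \<open>O(s \<beta> / \<alpha> * (1 + ln (\<beta> R\<^sup>2 / \<epsilon>)))\<close> steps
  suffice.  When \<open>\<beta> R\<^sup>2 / \<epsilon>\<close> is less than \<open>3\<close> the logarithm does not absorb the constant \<open>1\<close>;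
  in this case the decrease by \<open>\<epsilon>\<^sup>2 / (8 \<beta> R\<^sup>2)\<close> in each non-drop step already bounds the number of
  steps by a constant.\<close>

section \<open>Smooth convex functions and the \<open>l1\<close> norm\<close>

lemma l1norm_nonneg: "0 \<le> l1norm x"
  by (simp add: l1norm_def sum_nonneg)

lemma l1norm_scaleR: "l1norm (c *\<^sub>R x) = \<bar>c\<bar> * l1norm x"
  by (simp add: l1norm_def abs_mult sum_distrib_left)

lemma l1norm_add_le: "l1norm (x + y) \<le> l1norm x + l1norm y"
  by (simp add: l1norm_def flip: sum.distrib) (intro sum_mono abs_triangle_ineq)

lemma l1norm_diff_le: "l1norm (x - y) \<le> l1norm x + l1norm y"
  using l1norm_add_le[of x "- y"] l1norm_scaleR[of "-1" y] by simp

lemma l1norm_sum_le: "l1norm (\<Sum>i\<in>I. g i) \<le> (\<Sum>i\<in>I. l1norm (g i))"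
proof (induction I rule: infinite_finite_induct)
  case (insert i I)
  then show ?case using l1norm_add_le[of "g i" "sum g I"] by simp
qed (simp_all add: l1norm_def)

lemma continuous_on_l1norm: "continuous_on A l1norm"
  unfolding l1norm_def by (intro continuous_intros)

lemma norm_le_l1norm: "norm x \<le> l1norm x"
  by (simp add: l1norm_def norm_le_l1_cart)

lemma compact_l1ball: "compact (l1ball R)"
proof -
  have "closed (l1ball R :: (real^'n) set)"
    unfolding l1ball_def by (intro closed_Collect_le continuous_on_l1norm continuous_on_const)
  moreover have "bounded (l1ball R :: (real^'n) set)"
    unfolding bounded_iff l1ball_def using norm_le_l1norm order_trans by blast
  ultimately show ?thesis by (simp add: compact_eq_bounded_closed)
qed

text \<open>Hoelder's inequality for a dual pair of norms; it turns the Lipschitz bound on the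
  gradient into a bound on directional derivatives.\<close>

lemma inner_le_infnorm_l1norm:
  fixes x y :: "real^'n"
  shows "x \<bullet> y \<le> infnorm x * l1norm y"
proof -
  have "x \<bullet> y \<le> (\<Sum>i\<in>UNIV. infnorm x * \<bar>y $ i\<bar>)"
    unfolding inner_vec_def inner_real_def
  proof (rule sum_mono)
    fix i
    have "x $ i * y $ i \<le> \<bar>x $ i\<bar> * \<bar>y $ i\<bar>" by (metis abs_ge_self abs_mult)
    also have "\<dots> \<le> infnorm x * \<bar>y $ i\<bar>"
      by (intro mult_right_mono component_le_infnorm_cart) simp
    finally show "x $ i * y $ i \<le> infnorm x * \<bar>y $ i\<bar>" .
  qed
  then show ?thesis by (simp add: l1norm_def sum_distrib_left)
qed

section \<open>Convexity and smoothness along lines\<close>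

lemma has_real_derivative_along_line:
  assumes "\<And>y. GDERIV f y :> df y"
  shows "((\<lambda>c. f (x + c *\<^sub>R d)) has_real_derivative df (x + c *\<^sub>R d) \<bullet> d) (at c)"
proof -
  have "((\<lambda>c. f (x + c *\<^sub>R d)) has_derivative (\<lambda>h. (h *\<^sub>R d) \<bullet> df (x + c *\<^sub>R d))) (at c)"
    using assms unfolding gderiv_def
    by (intro has_derivative_compose[where g = f and f = "\<lambda>c. x + c *\<^sub>R d"])
      (auto intro!: derivative_eq_intros)
  then show ?thesis
    by (simp add: has_field_derivative_def inner_commute mult.commute[of _ "d \<bullet> _"] mult_commute_abs)
qed

lemma convex_on_along_line:
  assumes "convex_on UNIV f"
  shows "convex_on UNIV (\<lambda>c::real. f (x + c *\<^sub>R d))"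
proof (rule convex_onI)
  fix t a b :: real
  assume "0 < t" "t < 1"
  moreover have "x + ((1 - t) *\<^sub>R a + t *\<^sub>R b) *\<^sub>R d
      = (1 - t) *\<^sub>R (x + a *\<^sub>R d) + t *\<^sub>R (x + b *\<^sub>R d)"
    by (simp add: algebra_simps)
  ultimately show "f (x + ((1 - t) *\<^sub>R a + t *\<^sub>R b) *\<^sub>R d)
      \<le> (1 - t) * f (x + a *\<^sub>R d) + t * f (x + b *\<^sub>R d)"
    using assms by (simp only: convex_onD UNIV_I less_imp_le)
qed simp

text \<open>On the line through \<open>x\<close> and \<open>y\<close>, \<open>f\<close> is a convex
  function of one variable and lies above its tangent at \<open>0\<close>.\<close>

lemma convex_above_gradient:
  assumes "convex_on UNIV f" and "\<And>y. GDERIV f y :> df y"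
  shows "f x + df x \<bullet> (y - x) \<le> f y"
proof -
  have "((\<lambda>c. f (x + c *\<^sub>R (y - x))) has_real_derivative df x \<bullet> (y - x)) (at 0)"
    using has_real_derivative_along_line[OF assms(2), of x "y - x" 0] by simp
  with convex_on_along_line[OF assms(1)]
  have "df x \<bullet> (y - x) * (1 - 0) \<le> f (x + 1 *\<^sub>R (y - x)) - f (x + 0 *\<^sub>R (y - x))"
    by (intro convex_on_imp_above_tangent[of UNIV "\<lambda>c. f (x + c *\<^sub>R (y - x))"]) auto
  then show ?thesis by simp
qed

text \<open>Descent lemma. With the linear and quadratic terms moved to the left, the function
  \<open>\<psi>\<close> has nonpositive derivative by Hoelder and the Lipschitz bound, so it stays
  below its value at \<open>0\<close>.\<close>

lemma smooth_upper_bound: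
  fixes f :: "real^'n \<Rightarrow> real"
  assumes deriv: "\<And>y. GDERIV f y :> df y"
    and lip: "\<And>x y. infnorm (df x - df y) \<le> \<beta> * l1norm (x - y)"
    and c: "0 \<le> c"
  shows "f (x + c *\<^sub>R d) \<le> f x + c * (df x \<bullet> d) + \<beta> * c\<^sup>2 * (l1norm d)\<^sup>2 / 2"
proof -
  define \<psi> where "\<psi> = (\<lambda>c. f (x + c *\<^sub>R d) - c * (df x \<bullet> d) - \<beta> * c\<^sup>2 * (l1norm d)\<^sup>2 / 2)"
  have "\<psi> c \<le> \<psi> 0"
  proof (rule DERIV_nonpos_imp_nonincreasing[OF c])
    fix t :: real
    assume t: "0 \<le> t" "t \<le> c"
    have "(df (x + t *\<^sub>R d) - df x) \<bullet> d \<le> infnorm (df (x + t *\<^sub>R d) - df x) * l1norm d"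
      by (rule inner_le_infnorm_l1norm)
    also have "\<dots> \<le> (\<beta> * (t * l1norm d)) * l1norm d"
      using lip[of "x + t *\<^sub>R d" x] t
      by (intro mult_right_mono) (simp_all add: l1norm_nonneg l1norm_scaleR)
    finally have "df (x + t *\<^sub>R d) \<bullet> d - df x \<bullet> d - \<beta> * (2 * t) * (l1norm d)\<^sup>2 / 2 \<le> 0"
      by (simp add: inner_diff_left power2_eq_square mult_ac)
    moreover have "(\<psi> has_real_derivative
        df (x + t *\<^sub>R d) \<bullet> d - df x \<bullet> d - \<beta> * (2 * t) * (l1norm d)\<^sup>2 / 2) (at t)"
      unfolding \<psi>_def
      by (auto intro!: derivative_eq_intros has_real_derivative_along_line[OF deriv])
    ultimately show "\<exists>y. (\<psi> has_real_derivative y) (at t) \<and> y \<le> 0" by blast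
  qed
  then show ?thesis by (simp add: \<psi>_def)
qed

text \<open>If some \<open>c\<close> beyond the cap \<open>m\<close> were better than
  \<open>\<gamma>\<close>, then \<open>m\<close> would lie between the two and convexity would make
  it better than \<open>\<gamma>\<close> as well. So an away step can be compared with step sizes
  that exceed its cap.\<close>

lemma convex_line_search_interior:
  assumes "convex_on UNIV f" and "line_search f x d m \<gamma>" and "\<gamma> < m" and "0 \<le> c"
  shows "f (x + \<gamma> *\<^sub>R d) \<le> f (x + c *\<^sub>R d)"
proof (rule ccontr)
  assume neg: "\<not> ?thesis"
  define \<phi> where "\<phi> = (\<lambda>c. f (x + c *\<^sub>R d))"
  have ls: "0 \<le> \<gamma>" "\<And>c. 0 \<le> c \<Longrightarrow> c \<le> m \<Longrightarrow> \<phi> \<gamma> \<le> \<phi> c"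
    using assms(2) by (auto simp: line_search_def is_arg_min_linorder \<phi>_def)
  have less: "\<phi> c < \<phi> \<gamma>" using neg by (simp add: \<phi>_def)
  with ls assms have "m < c" by (meson not_le)
  define t where "t = (m - \<gamma>) / (c - \<gamma>)"
  have "t * (c - \<gamma>) = m - \<gamma>" using \<open>\<gamma> < m\<close> \<open>m < c\<close> by (simp add: t_def)
  then have "(1 - t) * \<gamma> + t * c = m" by (simp add: algebra_simps)
  moreover have "0 < t" "t \<le> 1" using \<open>\<gamma> < m\<close> \<open>m < c\<close> by (simp_all add: t_def)
  ultimately have t: "0 < t" "t \<le> 1" "(1 - t) * \<gamma> + t * c = m" by simp_all
  have "\<phi> ((1 - t) *\<^sub>R \<gamma> + t *\<^sub>R c) \<le> (1 - t) * \<phi> \<gamma> + t * \<phi> c"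
    using convex_on_along_line[OF assms(1)] t unfolding \<phi>_def by (intro convex_onD) auto
  also have "\<dots> < \<phi> \<gamma>" using t less by (simp add: algebra_simps)
  finally show False using ls(2)[of m] ls(1) t(3) \<open>\<gamma> < m\<close> by simp
qed

section \<open>Vertices and weights\<close>

lemma inj_vertex: "R \<noteq> 0 \<Longrightarrow> inj (vertex R)"
  by (rule injI) (auto simp: vertex_def vec_eq_iff axis_def split: if_splits prod.splits)

lemma vertex_eq_iff: "R \<noteq> 0 \<Longrightarrow> vertex R k = vertex R l \<longleftrightarrow> k = l"
  using inj_vertex by (rule inj_eq)

lemma finite_vertices [simp]: "finite (vertices R)"
  by (simp add: vertices_def)

lemma l1norm_vertex: "l1norm (vertex R k) = \<bar>R\<bar>"
  by (simp add: l1norm_def vertex_def axis_def if_distrib[of "\<lambda>x. \<bar>R * x\<bar>"] if_distrib[of "\<lambda>x. \<bar>x\<bar>"]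
      sum.delta cong: if_cong)

lemma l1norm_vertices: "v \<in> vertices R \<Longrightarrow> l1norm v = \<bar>R\<bar>"
  by (auto simp: vertices_def l1norm_vertex)

lemma inner_vertex: "x \<bullet> vertex R k = (if fst k then R else - R) * x $ snd k"
  by (simp add: vertex_def inner_axis)

text \<open>Comparing \<open>u\<close> with both signs of every axis vertex bounds \<open>R\<close>
  times each absolute gradient entry by \<open>- (df x \<bullet> u)\<close>; summing against the
  entries of \<open>y\<close> then costs a factor of at most \<open>R\<close>.\<close>

lemma lmo_le_inner:
  assumes "lmo df R x u" and "0 < R" and "y \<in> l1ball R"
  shows "df x \<bullet> u \<le> df x \<bullet> y"
proof -
  define m where "m = df x \<bullet> u"
  have m: "m \<le> df x \<bullet> vertex R k" for k
    using assms(1) by (auto simp: m_def lmo_def is_arg_min_linorder vertices_def)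
  have abs: "R * \<bar>df x $ i\<bar> \<le> - m" for i
    using m[of "(True, i)"] m[of "(False, i)"] by (auto simp: inner_vertex abs_if)
  \<comment> \<open>Here \<open>undefined\<close> stands for an arbitrary coordinate.\<close>
  have "0 \<le> - m" using abs[of undefined] \<open>0 < R\<close> by (meson abs_ge_zero mult_nonneg_nonneg less_imp_le order_trans)
  have "R * - (df x \<bullet> y) \<le> (\<Sum>i\<in>UNIV. - m * \<bar>y $ i\<bar>)"
    unfolding inner_vec_def inner_real_def sum_negf[symmetric] sum_distrib_left
  proof (rule sum_mono)
    fix i
    have "R * - (df x $ i * y $ i) \<le> (R * \<bar>df x $ i\<bar>) * \<bar>y $ i\<bar>"
      using \<open>0 < R\<close> by (simp add: mult.assoc flip: abs_mult)
        (metis abs_ge_minus_self minus_le_iff mult_left_mono less_imp_le mult_minus_right)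
    also have "\<dots> \<le> - m * \<bar>y $ i\<bar>" by (intro mult_right_mono abs) simp
    finally show "R * - (df x $ i * y $ i) \<le> - m * \<bar>y $ i\<bar>" .
  qed
  also have "\<dots> = - m * l1norm y" by (simp add: l1norm_def sum_distrib_left)
  also have "\<dots> \<le> - m * R"
    using assms(3) \<open>0 \<le> - m\<close> by (intro mult_left_mono) (auto simp: l1ball_def)
  finally have "R * m \<le> R * (df x \<bullet> y)" by (simp add: mult.commute)
  then show ?thesis using \<open>0 < R\<close> by (simp add: m_def)
qed

section \<open>Convex combinations of vertices\<close>

text \<open>The invariant of a run. Weights outside \<open>vertices R\<close> are left
  unconstrained.\<close>

definition valid :: "real \<Rightarrow> 'n::finite afw_state \<Rightarrow> bool" where
  "valid R st \<longleftrightarrow> (\<forall>v\<in>vertices R. 0 \<le> snd st v) \<and> (\<Sum>v\<in>vertices R. snd st v) = 1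
     \<and> (\<Sum>v\<in>vertices R. snd st v *\<^sub>R v) = fst st"

lemma valid_l1ball:
  assumes "valid R st" and "0 < R"
  shows "fst st \<in> l1ball R"
proof -
  have "l1norm (fst st) \<le> (\<Sum>v\<in>vertices R. l1norm (snd st v *\<^sub>R v))"
    using assms(1) l1norm_sum_le unfolding valid_def by metis
  also have "\<dots> = (\<Sum>v\<in>vertices R. snd st v * R)"
    using assms by (intro sum.cong) (auto simp: valid_def l1norm_scaleR l1norm_vertices)
  also have "\<dots> = R" using assms(1) by (simp add: valid_def flip: sum_distrib_right)
  finally show ?thesis by (simp add: l1ball_def)
qed

lemma finite_active [simp]: "finite (active R wt)"
  by (simp add: active_def)

lemma active_nonempty:
  assumes "valid R st"
  shows "active R (snd st) \<noteq> {}"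
proof
  assume "active R (snd st) = {}"
  then have "\<forall>v\<in>vertices R. snd st v = 0"
    using assms by (force simp: active_def valid_def)
  then have "(\<Sum>v\<in>vertices R. snd st v) = 0" by simp
  with assms show False by (simp add: valid_def)
qed

lemma valid_init:
  assumes "v \<in> vertices R"
  shows "valid R (v, \<lambda>v'. if v' = v then 1 else 0)"
  using assms by (simp add: valid_def if_distrib[of "\<lambda>c. c *\<^sub>R _"] cong: if_cong)

lemma active_init:
  assumes "v \<in> vertices R"
  shows "active R (\<lambda>v'. if v' = v then 1 else 0) = {v}"
  using assms by (auto simp: active_def split: if_splits)

text \<open>Covers both kinds of step: \<open>c = 1 - \<gamma>\<close> and
  \<open>a = \<gamma>\<close> for a Frank-Wolfe step, \<open>c = 1 + \<gamma>\<close> and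
  \<open>a = - \<gamma>\<close> for an away step.\<close>

lemma sum_weights_update:
  fixes c a :: real
  assumes "valid R st" and "u \<in> vertices R"
  shows "(\<Sum>v\<in>vertices R. c * snd st v + (if v = u then a else 0)) = c + a"
    and "(\<Sum>v\<in>vertices R. (c * snd st v + (if v = u then a else 0)) *\<^sub>R v) = c *\<^sub>R fst st + a *\<^sub>R u"
proof -
  show "(\<Sum>v\<in>vertices R. c * snd st v + (if v = u then a else 0)) = c + a"
    using assms by (simp add: valid_def sum.distrib flip: sum_distrib_left)
  have "(\<Sum>v\<in>vertices R. (c * snd st v + (if v = u then a else 0)) *\<^sub>R v)
      = c *\<^sub>R (\<Sum>v\<in>vertices R. snd st v *\<^sub>R v) + (\<Sum>v\<in>vertices R. if v = u then a *\<^sub>R u else 0)"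
    unfolding scaleR_sum_right sum.distrib[symmetric]
    by (rule sum.cong) (auto simp: scaleR_add_left)
  then show "(\<Sum>v\<in>vertices R. (c * snd st v + (if v = u then a else 0)) *\<^sub>R v) = c *\<^sub>R fst st + a *\<^sub>R u"
    using assms by (simp add: valid_def)
qed

text \<open>Full weight on \<open>w\<close> would force all other weights to zero. This makes the
  denominator in the cap of an away step positive.\<close>

lemma weight_less_1:
  assumes "valid R st" and "w \<in> vertices R" and "fst st \<noteq> w"
  shows "snd st w < 1"
proof (rule ccontr)
  assume neg: "\<not> snd st w < 1"
  have nn: "\<forall>v\<in>vertices R. 0 \<le> snd st v" and s1: "(\<Sum>v\<in>vertices R. snd st v) = 1"
    and x: "(\<Sum>v\<in>vertices R. snd st v *\<^sub>R v) = fst st"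
    using assms(1) by (auto simp: valid_def)
  have split: "snd st w + (\<Sum>v\<in>vertices R - {w}. snd st v) = 1"
    using s1 assms(2) by (simp add: sum.remove)
  moreover have "0 \<le> (\<Sum>v\<in>vertices R - {w}. snd st v)" using nn by (intro sum_nonneg) auto
  ultimately have w1: "snd st w = 1" and "(\<Sum>v\<in>vertices R - {w}. snd st v) = 0"
    using neg by linarith+
  then have "\<forall>v\<in>vertices R - {w}. snd st v = 0"
    using nn by (subst (asm) sum_nonneg_eq_0_iff) auto
  then have "(\<Sum>v\<in>vertices R. snd st v *\<^sub>R v) = w"
    using assms(2) w1 by (simp add: sum.remove)
  with x assms(3) show False by simp
qed

text \<open>The assumption \<open>l1norm z = R\<close> makes the weights \<open>\<bar>z $ i\<bar> / R\<close> of the signed coordinates of \<open>z\<close> sum to one.\<close>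

lemma inner_diff_le_pairwise_gap:
  fixes z :: "real^'n"
  assumes valid: "valid R st" and R: "0 < R" and z: "l1norm z = R"
    and M: "\<And>v. v \<in> active R (snd st) \<Longrightarrow> g \<bullet> v \<le> M"
    and m: "\<And>v. v \<in> vertices R \<Longrightarrow> m \<le> g \<bullet> v" and "m \<le> M"
  shows "g \<bullet> (fst st - z) \<le> (\<Sum>i | z $ i \<noteq> 0. \<bar>(fst st - z) $ i\<bar>) / R * (M - m)"
proof -
  define x where "x = fst st"
  define lam where "lam = (\<lambda>k. snd st (vertex R k))"
  \<comment> \<open>The weight of \<open>z $ i\<close> goes to the vertex of matching sign; the
    opposite vertex gets \<open>0\<close>.\<close>
  define mu where "mu = (\<lambda>k::bool \<times> 'n. max 0 (if fst k then z $ snd k else - (z $ snd k)) / R)"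
  \<comment> \<open>When \<open>lam\<close> is transported to \<open>mu\<close>, \<open>pos\<close>
    is the mass leaving a vertex and \<open>miss\<close> the mass arriving; the totals agree because
    both weightings sum to one.\<close>
  define pos where "pos = (\<lambda>k. max 0 (lam k - mu k))"
  define miss where "miss = (\<lambda>k. max 0 (mu k - lam k))"
  have reindex: "(\<Sum>v\<in>vertices R. h v) = (\<Sum>k\<in>UNIV. h (vertex R k))"
    for h :: "real^'n \<Rightarrow> 'b::comm_monoid_add"
    unfolding vertices_def using inj_vertex[of R] R by (subst sum.reindex) auto
  have split: "(\<Sum>k\<in>UNIV. h k) = (\<Sum>i\<in>UNIV. h (True, i) + h (False, i))"
    for h :: "bool \<times> 'n \<Rightarrow> 'b::comm_monoid_add"
  proof -
    have "sum h UNIV = (\<Sum>b\<in>UNIV. \<Sum>i\<in>UNIV. h (b, i))"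
      by (simp add: sum.cartesian_product)
    then show ?thesis by (simp add: UNIV_bool sum.distrib add.commute)
  qed
  have lam0: "0 \<le> lam k" for k
    using valid by (cases k) (simp add: valid_def lam_def vertices_def)
  have lam1: "(\<Sum>k\<in>UNIV. lam k) = 1" and lamx: "(\<Sum>k\<in>UNIV. lam k *\<^sub>R vertex R k) = x"
    using valid by (auto simp: valid_def lam_def x_def reindex)
  have comb_nth: "(\<Sum>k\<in>UNIV. c k *\<^sub>R vertex R k) $ i = R * (c (True, i) - c (False, i))"
    for c :: "bool \<times> 'n \<Rightarrow> real" and i
  proof -
    have "(\<Sum>k\<in>UNIV. c k *\<^sub>R vertex R k) $ i
        = (\<Sum>j\<in>UNIV. if j = i then R * (c (True, i) - c (False, i)) else 0)"
      unfolding sum_component split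
      by (rule sum.cong) (auto simp: vertex_def axis_def right_diff_distrib)
    then show ?thesis by simp
  qed
  have x_nth: "x $ i = R * (lam (True, i) - lam (False, i))" for i
    unfolding lamx[symmetric] by (rule comb_nth)
  have mu0: "0 \<le> mu k" for k using R by (simp add: mu_def)
  have "mu (True, i) + mu (False, i) = \<bar>z $ i\<bar> / R" for i
    by (simp add: mu_def abs_if max_def flip: add_divide_distrib)
  then have mu1: "(\<Sum>k\<in>UNIV. mu k) = 1"
    unfolding split using z R by (simp add: l1norm_def flip: sum_divide_distrib)
  have "(\<Sum>k\<in>UNIV. mu k *\<^sub>R vertex R k) $ i = z $ i" for i
    unfolding comb_nth using R by (simp add: mu_def max_def)
  then have muz: "(\<Sum>k\<in>UNIV. mu k *\<^sub>R vertex R k) = z" by (simp add: vec_eq_iff)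
  have diff: "lam k - mu k = pos k - miss k" for k by (simp add: pos_def miss_def max_def)
  have "(\<Sum>k\<in>UNIV. pos k - miss k) = 0"
    using lam1 mu1 by (simp add: diff[symmetric] sum_subtractf)
  then have mass: "(\<Sum>k\<in>UNIV. pos k) = (\<Sum>k\<in>UNIV. miss k)" by (simp add: sum_subtractf)
  have "g \<bullet> (x - z) = (\<Sum>k\<in>UNIV. (lam k - mu k) * (g \<bullet> vertex R k))"
    unfolding lamx[symmetric] muz[symmetric]
    by (simp add: inner_diff_right inner_sum_right algebra_simps flip: sum_subtractf)
  also have "\<dots> \<le> (\<Sum>k\<in>UNIV. pos k * M - miss k * m)"
  proof (rule sum_mono)
    fix k
    have "pos k * (g \<bullet> vertex R k) \<le> pos k * M"
    \<comment> \<open>The bound \<open>M\<close> is available on active vertices only, but mass can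
      leave a vertex only if it carries some.\<close>
    proof (cases "0 < lam k")
      case True
      then have "vertex R k \<in> active R (snd st)" by (simp add: active_def lam_def vertices_def)
      then show ?thesis by (intro mult_left_mono M) (auto simp: pos_def)
    next
      case False
      then have "pos k = 0" using mu0[of k] by (simp add: pos_def)
      then show ?thesis by simp
    qed
    moreover have "miss k * m \<le> miss k * (g \<bullet> vertex R k)"
      by (intro mult_left_mono m) (auto simp: miss_def vertices_def)
    ultimately show "(lam k - mu k) * (g \<bullet> vertex R k) \<le> pos k * M - miss k * m"
      unfolding diff by (simp add: left_diff_distrib)
  qed
  also have "\<dots> = (\<Sum>k\<in>UNIV. miss k) * (M - m)"
    by (simp add: sum_subtractf mass right_diff_distrib flip: sum_distrib_right)
  also have "\<dots> \<le> (\<Sum>i | z $ i \<noteq> 0. \<bar>(x - z) $ i\<bar>) / R * (M - m)"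
  proof (rule mult_right_mono)
    have "(\<Sum>k\<in>UNIV. miss k) \<le> (\<Sum>i\<in>UNIV. if z $ i \<noteq> 0 then \<bar>(x - z) $ i\<bar> / R else 0)"
      unfolding split
    proof (rule sum_mono)
      fix i
      define y where "y = z $ i / R"
      have z_nth: "z $ i = R * y" using R by (simp add: y_def)
      have mu_y: "mu (True, i) = max 0 y" "mu (False, i) = max 0 (- y)"
        using R by (simp_all add: mu_def z_nth max_def mult_le_0_iff zero_le_mult_iff)
      have "(x - z) $ i = R * (lam (True, i) - lam (False, i) - y)"
        by (simp add: x_nth z_nth algebra_simps)
      then have "\<bar>(x - z) $ i\<bar> / R = \<bar>lam (True, i) - lam (False, i) - y\<bar>"
        using R by (simp add: abs_mult)
      \<comment> \<open>At most one of the two signs has positive target weight, and mass on the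
        opposite sign only enlarges the distance. For \<open>y = 0\<close> nothing has to arrive,
        which restricts the sum to the support of \<open>z\<close>.\<close>
      moreover have "miss (True, i) + miss (False, i)
          \<le> (if y \<noteq> 0 then \<bar>lam (True, i) - lam (False, i) - y\<bar> else 0)"
        using lam0[of "(True, i)"] lam0[of "(False, i)"]
        unfolding miss_def mu_y max_def abs_if by (auto split: if_splits)
      moreover have "z $ i \<noteq> 0 \<longleftrightarrow> y \<noteq> 0" using R by (simp add: z_nth)
      ultimately show "miss (True, i) + miss (False, i) \<le> (if z $ i \<noteq> 0 then \<bar>(x - z) $ i\<bar> / R else 0)"
        by (cases "y = 0") simp_all
    qed
    also have "\<dots> = (\<Sum>i | z $ i \<noteq> 0. \<bar>(x - z) $ i\<bar>) / R"
      by (simp add: sum.If_cases Collect_neg_eq sum_divide_distrib)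
    finally show "(\<Sum>k\<in>UNIV. miss k) \<le> (\<Sum>i | z $ i \<noteq> 0. \<bar>(x - z) $ i\<bar>) / R" .
  qed (use \<open>m \<le> M\<close> in simp)
  finally show ?thesis by (simp add: x_def)
qed

text \<open>Cauchy-Schwarz against the constant \<open>1\<close> on the support of \<open>z\<close>;
  this is where sparsity enters the rate.\<close>

lemma sum_abs_support_squared_le:
  fixes y z :: "real^'n"
  shows "(\<Sum>i | z $ i \<noteq> 0. \<bar>y $ i\<bar>)\<^sup>2 \<le> real (nnz z) * (norm y)\<^sup>2"
proof -
  have "(\<Sum>i | z $ i \<noteq> 0. 1 * \<bar>y $ i\<bar>)\<^sup>2 \<le> (\<Sum>i | z $ i \<noteq> 0. 1\<^sup>2) * (\<Sum>i | z $ i \<noteq> 0. \<bar>y $ i\<bar>\<^sup>2)"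
    by (rule Cauchy_Schwarz_ineq_sum)
  also have "\<dots> \<le> real (nnz z) * (\<Sum>i\<in>UNIV. (y $ i)\<^sup>2)"
    by (simp add: nnz_def) (intro mult_left_mono sum_mono2, auto)
  also have "(\<Sum>i\<in>UNIV. (y $ i)\<^sup>2) = (norm y)\<^sup>2"
    unfolding power2_norm_eq_inner by (simp add: inner_vec_def power2_eq_square)
  finally show ?thesis by simp
qed

section \<open>Convergence of the algorithm\<close>

locale smooth_convex_on_l1ball =
  fixes f :: "real^'n \<Rightarrow> real" and df :: "real^'n \<Rightarrow> real^'n" and R \<beta> \<epsilon> :: real
  assumes convex: "convex_on UNIV f"
    and deriv: "\<And>x. GDERIV f x :> df x"
    and R_pos: "0 < R"
    and \<beta>_pos: "0 < \<beta>"
    and lipschitz: "\<And>x y. infnorm (df x - df y) \<le> \<beta> * l1norm (x - y)"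
    and \<epsilon>_pos: "0 < \<epsilon>"
begin

abbreviation "K \<equiv> \<beta> * R\<^sup>2"
abbreviation "h x \<equiv> f x - opt_value f R"

lemma K_pos: "0 < K"
  using R_pos \<beta>_pos by simp

lemma continuous_on_f: "continuous_on A f"
  using deriv unfolding gderiv_def
  by (meson continuous_at_imp_continuous_on has_derivative_continuous)

section \<open>Minimizers and feasible segments\<close>

lemma minimizers_nonempty: "minimizers f R \<noteq> {}"
proof -
  have "0 \<in> l1ball R" using R_pos by (simp add: l1ball_def l1norm_def)
  then obtain z where "z \<in> l1ball R" "\<forall>y\<in>l1ball R. f z \<le> f y"
    using continuous_attains_inf[OF compact_l1ball _ continuous_on_f] by blast
  then show ?thesis by (auto simp: minimizers_def)
qed

lemma opt_value_eq:
  assumes "z \<in> minimizers f R"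
  shows "opt_value f R = f z"
  unfolding opt_value_def using assms by (intro cInf_eq_minimum) (auto simp: minimizers_def)

lemma compact_minimizers: "compact (minimizers f R)"
proof -
  obtain z where z: "z \<in> minimizers f R" using minimizers_nonempty by blast
  have "minimizers f R = l1ball R \<inter> {x. f x \<le> f z}"
    using z by (auto simp: minimizers_def intro: order_trans)
  moreover have "closed {x. f x \<le> f z}"
    by (intro closed_Collect_le continuous_on_f continuous_on_const)
  ultimately show ?thesis using compact_Int_closed[OF compact_l1ball] by simp
qed

lemma opt_value_le:
  assumes "x \<in> l1ball R"
  shows "opt_value f R \<le> f x"
  using assms minimizers_nonempty opt_value_eq by (auto simp: minimizers_def)

text \<open>The infimum in the growth condition is attained because the set of minimizers is compact
  and nonempty.\<close>

lemma nearest_minimizer: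
  assumes "quadratic_growth f R \<alpha>" and "x \<in> l1ball R"
  obtains z where "z \<in> minimizers f R" and "(norm (x - z))\<^sup>2 \<le> 2 / \<alpha> * h x"
proof -
  obtain z where z: "z \<in> minimizers f R" "\<forall>y\<in>minimizers f R. (norm (x - z))\<^sup>2 \<le> (norm (x - y))\<^sup>2"
    by (rule bexE[OF continuous_attains_inf[OF compact_minimizers minimizers_nonempty,
          of "\<lambda>y. (norm (x - y))\<^sup>2"]]) (intro continuous_intros, blast)
  then have "(INF y\<in>minimizers f R. (norm (x - y))\<^sup>2) = (norm (x - z))\<^sup>2"
    by (intro cInf_eq_minimum) auto
  then show thesis using that[OF z(1)] assms by (auto simp: quadratic_growth_def)
qed

lemma quadratic_upper_bound:
  assumes "0 \<le> c" and "l1norm d \<le> 2 * R"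
  shows "f (x + c *\<^sub>R d) \<le> f x + c * (df x \<bullet> d) + 2 * K * c\<^sup>2"
proof -
  have "(l1norm d)\<^sup>2 \<le> (2 * R)\<^sup>2"
    by (rule power_mono[OF assms(2) l1norm_nonneg])
  then have "\<beta> * c\<^sup>2 * (l1norm d)\<^sup>2 \<le> \<beta> * c\<^sup>2 * (2 * R)\<^sup>2"
    using \<beta>_pos by (intro mult_left_mono) auto
  then show ?thesis
    using smooth_upper_bound[OF deriv lipschitz assms(1), of x d] by (simp add: power_mult_distrib mult_ac)
qed

lemma l1norm_direction:
  assumes "x \<in> l1ball R" and "v \<in> vertices R"
  shows "l1norm (v - x) \<le> 2 * R" and "l1norm (x - v) \<le> 2 * R"
  using assms R_pos l1norm_diff_le[of x v] l1norm_diff_le[of v x] l1norm_vertices[of v R]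
  by (auto simp: l1ball_def)

lemma segment_in_l1ball:
  assumes "x \<in> l1ball R" and "v \<in> vertices R" and "0 \<le> c" and "c \<le> 1"
  shows "x + c *\<^sub>R (v - x) \<in> l1ball R"
proof -
  have "x + c *\<^sub>R (v - x) = (1 - c) *\<^sub>R x + c *\<^sub>R v" by (simp add: algebra_simps)
  then have "l1norm (x + c *\<^sub>R (v - x)) \<le> (1 - c) * l1norm x + c * l1norm v"
    using l1norm_add_le[of "(1 - c) *\<^sub>R x" "c *\<^sub>R v"] assms by (simp add: l1norm_scaleR)
  also have "\<dots> \<le> (1 - c) * R + c * R"
    using assms R_pos by (intro add_mono mult_left_mono) (auto simp: l1ball_def l1norm_vertices)
  finally show ?thesis by (simp add: l1ball_def algebra_simps)
qed

lemma lmo_in_vertices: "lmo df R x u \<Longrightarrow> u \<in> vertices R"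
  by (simp add: lmo_def is_arg_min_linorder)

lemma away_vertex_in: "away_vertex df R st w \<Longrightarrow> w \<in> vertices R \<and> 0 < snd st w"
  by (simp add: away_vertex_def is_arg_max_linorder active_def)

section \<open>Frank-Wolfe gap and suboptimality\<close>

text \<open>Convexity bounds the suboptimality by the slope towards a minimizer, and no feasible
  point promises a larger linear decrease than \<open>u\<close>.\<close>

lemma h_le_gap:
  assumes "x \<in> l1ball R" and "lmo df R x u"
  shows "h x \<le> df x \<bullet> (x - u)"
proof -
  obtain z where z: "z \<in> minimizers f R" using minimizers_nonempty by blast
  then have "df x \<bullet> u \<le> df x \<bullet> z"
    by (intro lmo_le_inner[OF assms(2) R_pos]) (simp add: minimizers_def)
  then show ?thesis
    using convex_above_gradient[OF convex deriv, of x z] opt_value_eq[OF z]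
    by (simp add: inner_diff_right)
qed

text \<open>The point at fraction \<open>c\<close> of the way to \<open>u\<close> is feasible, so
  its value, bounded by the descent lemma, cannot fall below the optimum.\<close>

lemma h_ge_gap:
  assumes "x \<in> l1ball R" and "lmo df R x u" and "0 \<le> c" and "c \<le> 1"
  shows "c * (df x \<bullet> (x - u)) - 2 * K * c\<^sup>2 \<le> h x"
  using opt_value_le[OF segment_in_l1ball, of x u c] lmo_in_vertices[OF assms(2)]
    quadratic_upper_bound[OF assms(3) l1norm_direction(1), of x u x] assms
  by (simp add: inner_diff_right algebra_simps)

lemma gap_squared_le_h:
  assumes "x \<in> l1ball R" and "lmo df R x u" and "h x \<le> 2 * K"
  shows "df x \<bullet> (x - u) \<le> 4 * K" and "(df x \<bullet> (x - u))\<^sup>2 / (8 * K) \<le> h x"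
proof -
  define g where "g = df x \<bullet> (x - u)"
  have "0 \<le> g"
    using h_le_gap[OF assms(1,2)] opt_value_le[OF assms(1)] by (simp add: g_def)
  \<comment> \<open>The choice \<open>c = 1\<close> shows that \<open>g / (4 * K)\<close>, which
    maximizes the lower bound on \<open>h x\<close>, is an admissible fraction; it is used
    next.\<close>
  show "df x \<bullet> (x - u) \<le> 4 * K"
    using h_ge_gap[OF assms(1,2), of 1] assms(3) by simp
  then have "(g / (4 * K)) * g - 2 * K * (g / (4 * K))\<^sup>2 \<le> h x"
    using K_pos \<open>0 \<le> g\<close> unfolding g_def by (intro h_ge_gap assms) (auto simp: divide_simps)
  moreover have "(g / (4 * K)) * g - 2 * K * (g / (4 * K))\<^sup>2 = g\<^sup>2 / (8 * K)"
    using K_pos by (simp add: field_simps power2_eq_square)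
  ultimately show "(df x \<bullet> (x - u))\<^sup>2 / (8 * K) \<le> h x" by (simp add: g_def)
qed

lemma stop_imp_approx:
  assumes "valid R st" and "afw_stop df R \<epsilon> st"
  shows "approx_solution f R \<epsilon> (fst st)"
proof -
  obtain u where u: "lmo df R (fst st) u" "(- df (fst st)) \<bullet> (u - fst st) \<le> \<epsilon>"
    using assms(2) by (auto simp: afw_stop_def)
  have x: "fst st \<in> l1ball R" by (rule valid_l1ball[OF assms(1) R_pos])
  show ?thesis
    using h_le_gap[OF x u(1)] u(2) x by (simp add: approx_solution_def inner_diff_right)
qed

lemma not_stop_gap:
  assumes "\<not> afw_stop df R \<epsilon> st" and "lmo df R (fst st) u"
  shows "\<epsilon> < df (fst st) \<bullet> (fst st - u)"
  using assms by (force simp: afw_stop_def inner_diff_right)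

text \<open>The gap exceeds \<open>\<epsilon>\<close> as long as the test fails. The resulting floor
  under the suboptimality converts a decay rate into an iteration bound.\<close>

lemma not_stop_h:
  assumes "valid R st" and "\<not> afw_stop df R \<epsilon> st" and "lmo df R (fst st) u" and "h (fst st) \<le> 2 * K"
  shows "\<epsilon>\<^sup>2 / (8 * K) < h (fst st)"
proof -
  have "\<epsilon>\<^sup>2 < (df (fst st) \<bullet> (fst st - u))\<^sup>2"
    using not_stop_gap[OF assms(2,3)] \<epsilon>_pos by (intro power_strict_mono) auto
  then have "\<epsilon>\<^sup>2 / (8 * K) < (df (fst st) \<bullet> (fst st - u))\<^sup>2 / (8 * K)"
    using K_pos by (intro divide_strict_right_mono) auto
  then show ?thesis
    using gap_squared_le_h(2)[OF valid_l1ball[OF assms(1) R_pos] assms(3,4)] by linarith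
qed

section \<open>Progress of a single step\<close>

text \<open>The step size \<open>g / (4 * K)\<close> minimizes the upper model
  \<open>- c * g + 2 * K * c\<^sup>2\<close>.\<close>

lemma descent_optimal_step:
  assumes "l1norm d \<le> 2 * R" and "df x \<bullet> d \<le> - g" and "0 \<le> g"
  shows "f (x + (g / (4 * K)) *\<^sub>R d) \<le> f x - g\<^sup>2 / (8 * K)"
proof -
  have c: "0 \<le> g / (4 * K)" using K_pos assms(3) by simp
  then have "f (x + (g / (4 * K)) *\<^sub>R d) \<le> f x + g / (4 * K) * (- g) + 2 * K * (g / (4 * K))\<^sup>2"
    using quadratic_upper_bound[OF c assms(1), of x] mult_left_mono[OF assms(2) c] by linarith
  also have "\<dots> = f x - g\<^sup>2 / (8 * K)"
    using K_pos by (simp add: field_simps power2_eq_square)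
  finally show ?thesis .
qed

text \<open>\<open>g\<close> dominates both gaps. The alternative \<open>4 * K < ...\<close> covers
  Frank-Wolfe steps whose model step size exceeds \<open>1\<close>; it is excluded once the
  suboptimality is at most \<open>2 * K\<close>.\<close>

definition good_step :: "'n afw_state \<Rightarrow> 'n afw_state \<Rightarrow> bool" where
  "good_step st st' \<longleftrightarrow> card (active R (snd st')) \<le> Suc (card (active R (snd st))) \<and>
     (\<exists>u w g. lmo df R (fst st) u \<and> away_vertex df R st w \<and>
        df (fst st) \<bullet> (fst st - u) \<le> g \<and> df (fst st) \<bullet> (w - fst st) \<le> g \<and>
        (f (fst st') \<le> f (fst st) - g\<^sup>2 / (8 * K) \<or> 4 * K < df (fst st) \<bullet> (fst st - u)))"

text \<open>The steps that are not good are the drop steps: away steps whose step size is cut off at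
  \<open>\<gamma>max\<close>, which removes the away vertex from the active set.\<close>

lemma afw_step_properties:
  assumes valid: "valid R st" and not_stop: "\<not> afw_stop df R \<epsilon> st" and step: "afw_step f df R st st'"
  shows "valid R st'" and "f (fst st') \<le> f (fst st)"
    and "good_step st st' \<or> card (active R (snd st')) < card (active R (snd st))"
proof -
  define x where "x = fst st"
  define wt where "wt = snd st"
  obtain u w \<gamma> where u: "lmo df R x u" and w: "away_vertex df R st w"
    and upd: "if (- df x) \<bullet> (x - w) \<le> (- df x) \<bullet> (u - x)
        then line_search f x (u - x) 1 \<gamma> \<and>
             st' = (x + \<gamma> *\<^sub>R (u - x), \<lambda>v. (1 - \<gamma>) * wt v + (if v = u then \<gamma> else 0))
        else line_search f x (x - w) (wt w / (1 - wt w)) \<gamma> \<and>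
             st' = (x + \<gamma> *\<^sub>R (x - w), \<lambda>v. (1 + \<gamma>) * wt v - (if v = w then \<gamma> else 0))"
    using step unfolding afw_step_def Let_def x_def wt_def by blast
  note uV = lmo_in_vertices[OF u]
  have wV: "w \<in> vertices R" and w_pos: "0 < wt w"
    using away_vertex_in[OF w] by (auto simp: wt_def)
  have x: "x \<in> l1ball R" unfolding x_def by (rule valid_l1ball[OF valid R_pos])
  have wt0: "0 \<le> wt v" if "v \<in> vertices R" for v
    using valid that by (simp add: valid_def wt_def)
  have gap: "\<epsilon> < df x \<bullet> (x - u)" using not_stop_gap[OF not_stop] u by (simp add: x_def)
  have "valid R st' \<and> f (fst st') \<le> f x \<and>
    (good_step st st' \<or> card (active R (snd st')) < card (active R (snd st)))"
  proof (cases "(- df x) \<bullet> (x - w) \<le> (- df x) \<bullet> (u - x)")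
    case True
    with upd have ls: "line_search f x (u - x) 1 \<gamma>"
      and st': "st' = (x + \<gamma> *\<^sub>R (u - x), \<lambda>v. (1 - \<gamma>) * wt v + (if v = u then \<gamma> else 0))" by simp_all
    have \<gamma>: "0 \<le> \<gamma>" "\<gamma> \<le> 1" and min: "\<And>c. 0 \<le> c \<Longrightarrow> c \<le> 1 \<Longrightarrow> f (fst st') \<le> f (x + c *\<^sub>R (u - x))"
      using ls by (auto simp: line_search_def is_arg_min_linorder st')
    have "valid R st'"
      using sum_weights_update[OF valid uV, of "1 - \<gamma>" \<gamma>] \<gamma> wt0
      unfolding valid_def st' fst_conv snd_conv
      by (auto simp: wt_def x_def scaleR_diff_left scaleR_diff_right)
    moreover have "f (fst st') \<le> f x" using min[of 0] by simp
    moreover have "good_step st st'"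
    proof -
      have "active R (snd st') \<subseteq> insert u (active R wt)"
        using \<gamma> by (auto simp: active_def st' zero_less_mult_iff)
      then have "card (active R (snd st')) \<le> card (insert u (active R wt))"
        by (intro card_mono) auto
      also have "\<dots> \<le> Suc (card (active R wt))" by (simp add: card_insert_le_m1 card_insert_if)
      finally have c: "card (active R (snd st')) \<le> Suc (card (active R wt))" .
      have "f (fst st') \<le> f x - (df x \<bullet> (x - u))\<^sup>2 / (8 * K)" if "df x \<bullet> (x - u) \<le> 4 * K"
      proof -
        have "f (fst st') \<le> f (x + (df x \<bullet> (x - u) / (4 * K)) *\<^sub>R (u - x))"
          using that gap \<epsilon>_pos K_pos by (intro min) (auto simp: divide_simps)
        also have "\<dots> \<le> f x - (df x \<bullet> (x - u))\<^sup>2 / (8 * K)"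
          using gap \<epsilon>_pos l1norm_direction(1)[OF x uV]
          by (intro descent_optimal_step) (auto simp: inner_diff_right)
        finally show ?thesis .
      qed
      then show ?thesis
        using c u w True unfolding good_step_def wt_def x_def
        by (intro conjI exI[of _ u] exI[of _ w] exI[of _ "df (fst st) \<bullet> (fst st - u)"])
          (auto simp: inner_diff_right)
    qed
    ultimately show ?thesis by blast
  next
    case False
    with upd have ls: "line_search f x (x - w) (wt w / (1 - wt w)) \<gamma>"
      and st': "st' = (x + \<gamma> *\<^sub>R (x - w), \<lambda>v. (1 + \<gamma>) * wt v - (if v = w then \<gamma> else 0))" by simp_all
    have gA: "df x \<bullet> (x - u) < df x \<bullet> (w - x)" using False by (simp add: inner_diff_right)
    \<comment> \<open>At \<open>x = w\<close> the away gap would be zero, yet it exceeds the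
      positive Frank-Wolfe gap.\<close>
    have "x \<noteq> w" using gA gap \<epsilon>_pos by auto
    then have w1: "wt w < 1" using weight_less_1[OF valid wV] by (simp add: x_def wt_def)
    define m where "m = wt w / (1 - wt w)"
    have \<gamma>: "0 \<le> \<gamma>" "\<gamma> \<le> m" and min0: "f (fst st') \<le> f x"
    proof -
      show "0 \<le> \<gamma>" "\<gamma> \<le> m" using ls by (auto simp: line_search_def is_arg_min_linorder m_def)
      then have "0 \<in> {0..m}" by simp
      with ls have "f (x + \<gamma> *\<^sub>R (x - w)) \<le> f (x + 0 *\<^sub>R (x - w))"
        unfolding line_search_def is_arg_min_linorder m_def by blast
      then show "f (fst st') \<le> f x" by (simp add: st')
    qed
    have m: "(1 + m) * wt w - m = 0" using w1 by (simp add: m_def divide_simps)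
    \<comment> \<open>The factorization shows that the weight of \<open>w\<close> stays nonnegative
      up to the cap \<open>m\<close> and vanishes exactly there.\<close>
    have new_w: "(1 + \<gamma>) * wt w - \<gamma> = (m - \<gamma>) * (1 - wt w)"
      using m by (simp add: algebra_simps)
    have eq: "(\<lambda>v. (1 + \<gamma>) * wt v - (if v = w then \<gamma> else 0))
        = (\<lambda>v. (1 + \<gamma>) * wt v + (if v = w then - \<gamma> else 0))" by auto
    have nonneg: "0 \<le> (1 + \<gamma>) * wt v + (if v = w then - \<gamma> else 0)" if "v \<in> vertices R" for v
    proof (cases "v = w")
      case True
      then show ?thesis using new_w \<gamma> w1 by simp
    qed (use \<gamma> wt0[OF that] in auto)
    have "valid R st'"
      using sum_weights_update[OF valid wV, of "1 + \<gamma>" "- \<gamma>"] nonneg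
      unfolding valid_def st' fst_conv snd_conv eq
      by (auto simp: wt_def x_def scaleR_add_left scaleR_diff_right)
    have sub: "active R (snd st') \<subseteq> active R wt"
      using \<gamma> w_pos by (auto simp: active_def st' zero_less_mult_iff split: if_splits)
    have "good_step st st' \<or> card (active R (snd st')) < card (active R wt)"
    proof (cases "\<gamma> < m")
      case True
      \<comment> \<open>The model step size may lie beyond \<open>m\<close>; as the search ended
        before the cap, the comparison is still valid.\<close>
      have "f (fst st') \<le> f (x + (df x \<bullet> (w - x) / (4 * K)) *\<^sub>R (x - w))"
        using convex_line_search_interior[OF convex ls, of "df x \<bullet> (w - x) / (4 * K)"]
          True gap gA \<epsilon>_pos K_pos by (simp add: st' m_def)
      also have "\<dots> \<le> f x - (df x \<bullet> (w - x))\<^sup>2 / (8 * K)"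
        using gap gA \<epsilon>_pos l1norm_direction(2)[OF x wV]
        by (intro descent_optimal_step) (auto simp: inner_diff_right)
      finally have "f (fst st') \<le> f x - (df x \<bullet> (w - x))\<^sup>2 / (8 * K)" .
      moreover have "card (active R (snd st')) \<le> Suc (card (active R wt))"
        using card_mono[OF _ sub] by simp
      ultimately have "good_step st st'"
        using u w gA unfolding good_step_def wt_def x_def
        by (intro conjI exI[of _ u] exI[of _ w] exI[of _ "df (fst st) \<bullet> (w - fst st)"]) auto
      then show ?thesis ..
    next
      case False
      then have "\<gamma> = m" using \<gamma> by simp
      then have "w \<notin> active R (snd st')" using m by (simp add: active_def st')
      moreover have "w \<in> active R wt" using wV w_pos by (simp add: active_def)
      ultimately have "active R (snd st') \<subset> active R wt" using sub by blast
      then show ?thesis by (simp add: psubset_card_mono)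
    qed
    with \<open>valid R st'\<close> min0 show ?thesis by (simp add: wt_def)
  qed
  then show "valid R st'" "f (fst st') \<le> f (fst st)"
    "good_step st st' \<or> card (active R (snd st')) < card (active R (snd st))"
    by (auto simp: x_def)
qed

text \<open>At a vertex the away gap is zero, so a Frank-Wolfe step is taken. Comparison with the
  full step gives \<open>f v\<close> minus the gap plus \<open>2 * K\<close>, and the gap is at
  least \<open>h v\<close>, so the starting value cancels.\<close>

lemma first_step:
  assumes v: "v \<in> vertices R" and st: "st = (v, \<lambda>v'. if v' = v then 1 else 0)"
    and not_stop: "\<not> afw_stop df R \<epsilon> st" and step: "afw_step f df R st st'"
  shows "h (fst st') \<le> 2 * K" and "card (active R (snd st')) \<le> 2"
proof -
  have valid: "valid R st" unfolding st by (rule valid_init[OF v])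
  have act: "active R (snd st) = {v}" unfolding st snd_conv by (rule active_init[OF v])
  obtain u w \<gamma> where u: "lmo df R v u" and w: "away_vertex df R st w"
    and upd: "if (- df v) \<bullet> (v - w) \<le> (- df v) \<bullet> (u - v)
        then line_search f v (u - v) 1 \<gamma> \<and> fst st' = v + \<gamma> *\<^sub>R (u - v)
        else True"
    using step unfolding afw_step_def Let_def st fst_conv snd_conv by force
  have "w = v" using w act by (simp add: away_vertex_def is_arg_max_linorder)
  have gap: "\<epsilon> < df v \<bullet> (v - u)" using not_stop_gap[OF not_stop] u by (simp add: st)
  then have "line_search f v (u - v) 1 \<gamma>" and x': "fst st' = v + \<gamma> *\<^sub>R (u - v)"
    using upd \<epsilon>_pos by (simp_all add: \<open>w = v\<close> inner_diff_right split: if_splits)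
  then have "f (fst st') \<le> f (v + 1 *\<^sub>R (u - v))"
    unfolding line_search_def is_arg_min_linorder x' atLeastAtMost_iff
    using zero_le_one order_refl by blast
  also have "\<dots> \<le> f v + 1 * (df v \<bullet> (u - v)) + 2 * K * 1\<^sup>2"
    using valid_l1ball[OF valid R_pos] lmo_in_vertices[OF u]
    by (intro quadratic_upper_bound l1norm_direction) (auto simp: st)
  finally show "h (fst st') \<le> 2 * K"
    using h_le_gap[OF _ u] valid_l1ball[OF valid R_pos] by (simp add: st inner_diff_right)
  show "card (active R (snd st')) \<le> 2"
    using afw_step_properties(3)[OF valid not_stop step] by (auto simp: good_step_def act)
qed

lemma afw_run_valid:
  assumes "afw_run f df R \<epsilon> \<sigma>"
  shows "valid R (\<sigma> t)"
proof (induction t)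
  case 0
  then show ?case using assms valid_init by (auto simp: afw_run_def)
next
  case (Suc t)
  then show ?case
    using assms afw_step_properties(1) unfolding afw_run_def by (cases "afw_stop df R \<epsilon> (\<sigma> t)") metis+
qed

end

section \<open>Linear convergence and the iteration bound\<close>

locale sparse_optimum = smooth_convex_on_l1ball f df R \<beta> \<epsilon>
  for f :: "real^'n \<Rightarrow> real" and df R \<beta> \<epsilon> +
  fixes \<alpha> :: real and s :: nat
  assumes \<alpha>_pos: "0 < \<alpha>"
    and growth: "quadratic_growth f R \<alpha>"
    and sparse: "\<And>x. x \<in> minimizers f R \<Longrightarrow> nnz x \<le> s \<and> l1norm x = R"
begin

text \<open>Contraction rate per good step; \<open>64\<close> is the product of the \<open>8\<close>
  in the descent bound and the \<open>8\<close> in the bound of the suboptimality by the squared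
  gap.\<close>

definition "\<rho> = \<alpha> / (64 * real s * \<beta>)"

lemma s_pos: "0 < s"
proof -
  obtain z where z: "z \<in> minimizers f R" using minimizers_nonempty by blast
  have "\<exists>i. z $ i \<noteq> 0"
  proof (rule ccontr)
    assume "\<nexists>i. z $ i \<noteq> 0"
    then have "l1norm z = 0" by (simp add: l1norm_def)
    with sparse[OF z] R_pos show False by simp
  qed
  then have "0 < nnz z" by (auto simp: nnz_def card_gt_0_iff)
  with sparse[OF z] show ?thesis by simp
qed

lemma \<rho>_pos: "0 < \<rho>"
  using \<alpha>_pos \<beta>_pos s_pos by (simp add: \<rho>_def)

text \<open>The suboptimality is at most the transported mass times the pairwise gap. Squaring and
  bounding the mass by sparsity and quadratic growth leaves one factor \<open>h x\<close> on the
  right, which cancels.\<close>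

lemma gap_ge_suboptimality:
  assumes valid: "valid R st" and u: "lmo df R (fst st) u" and w: "away_vertex df R st w"
    and gFW: "df (fst st) \<bullet> (fst st - u) \<le> g" and gA: "df (fst st) \<bullet> (w - fst st) \<le> g"
  shows "\<rho> * h (fst st) \<le> g\<^sup>2 / (8 * K)"
proof (cases "h (fst st) = 0")
  case True
  then show ?thesis using K_pos by simp
next
  case False
  define x where "x = fst st"
  have x: "x \<in> l1ball R" unfolding x_def by (rule valid_l1ball[OF valid R_pos])
  have h_pos: "0 < h x" using False opt_value_le[OF x] by (simp add: x_def)
  obtain z where z: "z \<in> minimizers f R" and near: "(norm (x - z))\<^sup>2 \<le> 2 / \<alpha> * h x"
    using nearest_minimizer[OF growth x] by blast
  define \<Delta> where "\<Delta> = (\<Sum>i | z $ i \<noteq> 0. \<bar>(x - z) $ i\<bar>)"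
  have le: "df x \<bullet> u \<le> df x \<bullet> w"
    using u away_vertex_in[OF w] by (simp add: lmo_def is_arg_min_linorder x_def)
  have "h x \<le> df x \<bullet> (x - z)"
    using convex_above_gradient[OF convex deriv, of x z] opt_value_eq[OF z]
    by (simp add: inner_diff_right)
  also have "\<dots> \<le> \<Delta> / R * (df x \<bullet> w - df x \<bullet> u)"
    unfolding \<Delta>_def x_def
    using sparse[OF z] w u le
    by (intro inner_diff_le_pairwise_gap[OF valid R_pos])
      (auto simp: away_vertex_def is_arg_max_linorder lmo_def is_arg_min_linorder x_def)
  \<comment> \<open>The pairwise gap is the sum of the Frank-Wolfe gap and the away gap.\<close>
  also have "\<dots> \<le> \<Delta> / R * (2 * g)"
    using gFW gA R_pos by (intro mult_left_mono) (auto simp: \<Delta>_def x_def inner_diff_right sum_nonneg)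
  finally have "(h x)\<^sup>2 \<le> (\<Delta> / R * (2 * g))\<^sup>2" using h_pos by (intro power_mono) auto
  also have "\<dots> = \<Delta>\<^sup>2 * (4 * g\<^sup>2 / R\<^sup>2)" by (simp add: power_mult_distrib power_divide)
  also have "\<dots> \<le> (real s * (2 / \<alpha> * h x)) * (4 * g\<^sup>2 / R\<^sup>2)"
  proof (rule mult_right_mono)
    have "\<Delta>\<^sup>2 \<le> real (nnz z) * (norm (x - z))\<^sup>2" unfolding \<Delta>_def by (rule sum_abs_support_squared_le)
    also have "\<dots> \<le> real s * (2 / \<alpha> * h x)"
      using sparse[OF z] near by (intro mult_mono) auto
    finally show "\<Delta>\<^sup>2 \<le> real s * (2 / \<alpha> * h x)" .
  qed simp
  finally have "h x * h x \<le> (8 * real s * g\<^sup>2 / (\<alpha> * R\<^sup>2)) * h x"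
    by (simp add: power2_eq_square mult_ac)
  then have "h x \<le> 8 * real s * g\<^sup>2 / (\<alpha> * R\<^sup>2)" using h_pos by (rule mult_right_le_imp_le)
  then have "\<rho> * h x \<le> \<rho> * (8 * real s * g\<^sup>2 / (\<alpha> * R\<^sup>2))"
    using \<rho>_pos by (intro mult_left_mono) auto
  also have "\<dots> = g\<^sup>2 / (8 * K)"
    using \<alpha>_pos s_pos \<beta>_pos R_pos by (simp add: \<rho>_def field_simps)
  finally show ?thesis by (simp add: x_def)
qed

text \<open>\<open>G\<close> counts the good steps after the first step. A drop step does not
  increase the active-set size plus the step count, and a good step raises the sum by at most
  \<open>2\<close>. Both decay bounds are kept because small and large \<open>K / \<epsilon>\<close>
  use different ones.\<close>

lemma afw_run_progress:
  assumes run: "afw_run f df R \<epsilon> \<sigma>" and not_stop: "\<And>t. t \<le> Suc T \<Longrightarrow> \<not> afw_stop df R \<epsilon> (\<sigma> t)"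
  shows "\<exists>G::nat. card (active R (snd (\<sigma> (Suc T)))) + Suc T \<le> 2 * G + 3
    \<and> h (fst (\<sigma> (Suc T))) \<le> 2 * K * exp (- \<rho> * real G)
    \<and> h (fst (\<sigma> (Suc T))) \<le> 2 * K - real G * (\<epsilon>\<^sup>2 / (8 * K))"
  using not_stop
proof (induction T)
  case 0
  obtain v where "v \<in> vertices R" "\<sigma> 0 = (v, \<lambda>v'. if v' = v then 1 else 0)"
    using run by (auto simp: afw_run_def)
  moreover have "\<not> afw_stop df R \<epsilon> (\<sigma> 0)" using 0 by simp
  moreover from this have "afw_step f df R (\<sigma> 0) (\<sigma> (Suc 0))" using run by (simp add: afw_run_def)
  ultimately have "h (fst (\<sigma> (Suc 0))) \<le> 2 * K" "card (active R (snd (\<sigma> (Suc 0)))) \<le> 2"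
    by (rule first_step)+
  \<comment> \<open>After one step there are at most two active vertices, which accounts for the
    constant \<open>3\<close>.\<close>
  then show ?case by (intro exI[of _ 0]) simp
next
  case (Suc T)
  define st where "st = \<sigma> (Suc T)"
  define st' where "st' = \<sigma> (Suc (Suc T))"
  obtain G where card: "card (active R (snd st)) + Suc T \<le> 2 * G + 3"
    and lin: "h (fst st) \<le> 2 * K * exp (- \<rho> * real G)"
    and sublin: "h (fst st) \<le> 2 * K - real G * (\<epsilon>\<^sup>2 / (8 * K))"
    using Suc unfolding st_def by fastforce
  have valid: "valid R st" unfolding st_def by (rule afw_run_valid[OF run])
  have not_stop: "\<not> afw_stop df R \<epsilon> st" using Suc.prems by (simp add: st_def)
  have step: "afw_step f df R st st'" using run not_stop by (simp add: afw_run_def st_def st'_def)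
  have x: "fst st \<in> l1ball R" by (rule valid_l1ball[OF valid R_pos])
  have "0 \<le> real G * (\<epsilon>\<^sup>2 / (8 * K))" using K_pos by simp
  with sublin have h2K: "h (fst st) \<le> 2 * K" by linarith
  show ?case
    unfolding st'_def[symmetric]
  proof (cases "good_step st st'")
    case True
    \<comment> \<open>Since \<open>h (fst st) \<le> 2 * K\<close>, the Frank-Wolfe gap is at most
      \<open>4 * K\<close>, so the decrease in \<open>good_step\<close> must hold.\<close>
    then obtain u w g where u: "lmo df R (fst st) u" and w: "away_vertex df R st w"
      and gFW: "df (fst st) \<bullet> (fst st - u) \<le> g" and gA: "df (fst st) \<bullet> (w - fst st) \<le> g"
      and dec: "f (fst st') \<le> f (fst st) - g\<^sup>2 / (8 * K)"
      and card': "card (active R (snd st')) \<le> Suc (card (active R (snd st)))"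
      using gap_squared_le_h(1)[OF x _ h2K] unfolding good_step_def by force
    have "h (fst st') \<le> (1 - \<rho>) * h (fst st)"
      using dec gap_ge_suboptimality[OF valid u w gFW gA] by (simp only: left_diff_distrib mult_1)
    also have "\<dots> \<le> exp (- \<rho>) * h (fst st)"
      using exp_ge_add_one_self[of "- \<rho>"] opt_value_le[OF x] by (intro mult_right_mono) auto
    also have "\<dots> \<le> exp (- \<rho>) * (2 * K * exp (- \<rho> * real G))"
      using lin by (intro mult_left_mono) auto
    also have "\<dots> = 2 * K * exp (- \<rho> * real (Suc G))"
      by (simp add: algebra_simps exp_diff exp_minus divide_inverse exp_add)
    finally have lin': "h (fst st') \<le> 2 * K * exp (- \<rho> * real (Suc G))" .
    \<comment> \<open>The failed test puts the gap above \<open>\<epsilon>\<close>, so every good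
      step gains a fixed amount.\<close>
    have "\<epsilon>\<^sup>2 \<le> g\<^sup>2" using not_stop_gap[OF not_stop u] gFW \<epsilon>_pos by (intro power_mono) auto
    then have "\<epsilon>\<^sup>2 / (8 * K) \<le> g\<^sup>2 / (8 * K)" using K_pos by (intro divide_right_mono) auto
    then have "h (fst st') \<le> 2 * K - real (Suc G) * (\<epsilon>\<^sup>2 / (8 * K))"
      using dec sublin by (simp only: of_nat_Suc distrib_right)
    then show "\<exists>G::nat. card (active R (snd st')) + Suc (Suc T) \<le> 2 * G + 3
      \<and> h (fst st') \<le> 2 * K * exp (- \<rho> * real G) \<and> h (fst st') \<le> 2 * K - real G * (\<epsilon>\<^sup>2 / (8 * K))"
      using card card' lin' by (intro exI[of _ "Suc G"] conjI) simp_all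
  next
    case False
    then have "card (active R (snd st')) < card (active R (snd st))" "f (fst st') \<le> f (fst st)"
      using afw_step_properties[OF valid not_stop step] by auto
    then show "\<exists>G::nat. card (active R (snd st')) + Suc (Suc T) \<le> 2 * G + 3
      \<and> h (fst st') \<le> 2 * K * exp (- \<rho> * real G) \<and> h (fst st') \<le> 2 * K - real G * (\<epsilon>\<^sup>2 / (8 * K))"
      using card lin sublin by (intro exI[of _ G] conjI) linarith+
  qed
qed

lemma not_stopped_bound:
  assumes run: "afw_run f df R \<epsilon> \<sigma>" and not_stop: "\<And>t. t \<le> T \<Longrightarrow> \<not> afw_stop df R \<epsilon> (\<sigma> t)"
  shows "real T \<le> 1000 * max 1 (\<beta> * real s / \<alpha> * ln (K / \<epsilon>))"
proof (cases T)
  case 0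
  then show ?thesis by simp
next
  case (Suc T')
  define st where "st = \<sigma> T"
  define q where "q = K / \<epsilon>"
  have q_pos: "0 < q" using K_pos \<epsilon>_pos by (simp add: q_def)
  have q2: "\<epsilon>\<^sup>2 / (8 * K) = K / (8 * q\<^sup>2)"
    using K_pos \<epsilon>_pos by (simp add: q_def field_simps power2_eq_square)
  obtain G where card: "card (active R (snd st)) + T \<le> 2 * G + 3"
    and lin: "h (fst st) \<le> 2 * K * exp (- \<rho> * real G)"
    and sublin: "h (fst st) \<le> 2 * K - real G * (\<epsilon>\<^sup>2 / (8 * K))"
    using afw_run_progress[OF run, of T'] not_stop Suc unfolding st_def by blast
  have valid: "valid R st" unfolding st_def by (rule afw_run_valid[OF run])
  have ns: "\<not> afw_stop df R \<epsilon> st" using not_stop by (simp add: st_def)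
  obtain u where u: "lmo df R (fst st) u"
    unfolding lmo_def using ex_is_arg_min_if_finite[OF finite_vertices[of R]]
    by (metis empty_iff rangeI vertices_def)
  have "0 \<le> real G * (\<epsilon>\<^sup>2 / (8 * K))" using K_pos by simp
  with sublin have "h (fst st) \<le> 2 * K" by linarith
  then have low: "K / (8 * q\<^sup>2) < h (fst st)" using not_stop_h[OF valid ns u] by (simp add: q2)
  have "1 \<le> card (active R (snd st))"
    using active_nonempty[OF valid] by (simp add: Suc_le_eq card_gt_0_iff)
  with card have "T \<le> 2 * G + 2" by linarith
  then have TG: "real T \<le> 2 * real G + 2" by linarith
  show ?thesis
  proof (cases "q < 3")
    \<comment> \<open>The fixed gain per good step gives
      \<open>G \<le> 16 * 3\<^sup>2 = 144\<close>, hence at most \<open>290\<close> steps.\<close>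
    case True
    have "real G * (K / (8 * q\<^sup>2)) \<le> 2 * K"
      using sublin low q2 K_pos q_pos by (smt (verit) divide_nonneg_nonneg zero_le_power2)
    then have "real G * K \<le> (16 * q\<^sup>2) * K" using q_pos by (simp add: field_simps)
    then have "real G \<le> 16 * q\<^sup>2" using K_pos by (rule mult_right_le_imp_le)
    moreover have "q\<^sup>2 \<le> 3\<^sup>2" using True q_pos by (intro power_mono) auto
    ultimately have "real T \<le> 1000" using TG by simp
    then show ?thesis by linarith
  next
    case False
    \<comment> \<open>The threshold \<open>3\<close> exceeds Euler's number, so the logarithm can
      absorb additive constants.\<close>
    have L: "1 \<le> ln q"
      using False q_pos exp_le by (subst ln_ge_iff) auto
    have "K / (8 * q\<^sup>2) < 2 * K * exp (- \<rho> * real G)" using low lin by linarith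
    then have "exp (\<rho> * real G) * K < (16 * q\<^sup>2) * K"
      using q_pos by (simp add: exp_minus field_simps)
    then have "exp (\<rho> * real G) < 16 * q\<^sup>2" using K_pos by (simp only: mult_less_cancel_right_pos)
    then have "\<rho> * real G < ln (16 * q\<^sup>2)"
      using q_pos exp_ln[of "16 * q\<^sup>2"] exp_less_cancel_iff[of "\<rho> * real G" "ln (16 * q\<^sup>2)"] by simp
    also have "\<dots> = ln 16 + 2 * ln q" using q_pos by (simp add: ln_mult ln_realpow)
    \<comment> \<open>\<open>ln 16 = 4 * ln 2\<close>, which is below \<open>4\<close> and so at
      most \<open>4 * ln q\<close>.\<close>
    also have "\<dots> \<le> 6 * ln q"
      using ln_realpow[of 2 4] ln_2_less_1 L by simp
    finally have "real G \<le> 6 * ln q / \<rho>" using \<rho>_pos by (simp add: field_simps)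
    also have "\<dots> = 384 * (\<beta> * real s / \<alpha> * ln q)"
      using \<alpha>_pos \<beta>_pos s_pos by (simp add: \<rho>_def field_simps)
    finally have "real T \<le> 768 * (\<beta> * real s / \<alpha> * ln q) + 2" using TG by linarith
    also have "\<dots> \<le> 1000 * max 1 y" if "y = \<beta> * real s / \<alpha> * ln q" for y
      unfolding that[symmetric] by linarith
    finally show ?thesis by (simp only: q_def)
  qed
qed

lemma afw_stops:
  assumes run: "afw_run f df R \<epsilon> \<sigma>"
  defines "N \<equiv> max 1 (\<beta> * real s * max 1 (R\<^sup>2) / \<alpha> * ln (K / \<epsilon>))"
  shows "\<exists>T. real T \<le> 10 ^ 4 * N \<and> afw_stop df R \<epsilon> (\<sigma> T) \<and> approx_solution f R \<epsilon> (fst (\<sigma> T))"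
proof -
  \<comment> \<open>Multiplying by \<open>max 1 (R\<^sup>2)\<close> enlarges a nonnegative term;
    with a negative logarithm the \<open>1\<close> in \<open>N\<close> takes over.\<close>
  have "\<beta> * real s / \<alpha> * ln (K / \<epsilon>) \<le> N"
  proof (cases "0 \<le> ln (K / \<epsilon>)")
    case True
    have "\<beta> * real s / \<alpha> * ln (K / \<epsilon>) * 1 \<le> \<beta> * real s / \<alpha> * ln (K / \<epsilon>) * max 1 (R\<^sup>2)"
      using True \<beta>_pos \<alpha>_pos by (intro mult_left_mono) auto
    then show ?thesis unfolding N_def by (simp add: mult_ac)
  next
    case False
    then have "\<beta> * real s / \<alpha> * ln (K / \<epsilon>) \<le> 0"
      using \<beta>_pos \<alpha>_pos by (intro mult_nonneg_nonpos) auto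
    then show ?thesis by (simp add: N_def)
  qed
  then have N: "max 1 (\<beta> * real s / \<alpha> * ln (K / \<epsilon>)) \<le> N" "1 \<le> N" by (auto simp: N_def)
  have "\<exists>T. real T \<le> 10 ^ 4 * N \<and> afw_stop df R \<epsilon> (\<sigma> T)"
  proof (rule ccontr)
    assume neg: "\<not> ?thesis"
    \<comment> \<open>If the test failed through this \<open>T\<close>, then
      \<open>T \<le> 1000 * N\<close>, although \<open>T\<close> is within \<open>1\<close> of
      \<open>10 ^ 4 * N\<close>.\<close>
    define T where "T = nat \<lfloor>10 ^ 4 * N\<rfloor>"
    have T: "real T \<le> 10 ^ 4 * N" "10 ^ 4 * N < real T + 1" using N by (auto simp: T_def)
    have "\<not> afw_stop df R \<epsilon> (\<sigma> t)" if "t \<le> T" for t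
      using neg T(1) that by (metis of_nat_mono order_trans)
    then have "real T \<le> 1000 * N" using not_stopped_bound[OF run, of T] N by fastforce
    with T N show False by simp
  qed
  then show ?thesis using stop_imp_approx[OF afw_run_valid[OF run]] by blast
qed

end

section \<open>The program for a quadratic objective\<close>

text \<open>The \<open>let\<close> keeps intermediate results shared when the program is
  unfolded.\<close>

lemma fst_cbind: "fst (cbind m k) = (let y = fst m in fst (k y))"
  by (simp add: cbind_def)

lemma fst_Let: "fst (Let t F) = (let y = t in fst (F y))"
  by simp

lemma fst_cinner: "fst (cinner x y) = x \<bullet> y"
  by (simp add: cinner_def csum_def flop_def inner_vec_def)

lemma fst_csigned: "fst (csigned r s) = (if s then r else - r)"
  by (simp add: csigned_def creturn_def flop_def)

lemma fst_flop: "fst (flop a) = a"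
  by (simp add: flop_def)

lemma fst_creturn: "fst (creturn a) = a"
  by (simp add: creturn_def)

lemma fst_cvec: "fst (cvec F) = (\<chi> i. fst (F i))"
  by (simp add: cvec_def)

lemma fst_cpositive: "fst (cpositive v) = {i. 0 < v $ i}"
  by (simp add: cpositive_def)

lemma fst_cargmin: "fst (cargmin v I) = arg_min (($) v) (\<lambda>i. i \<in> I)"
  by (simp add: cargmin_def)

lemma fst_cargmax: "fst (cargmax v I) = arg_max (($) v) (\<lambda>i. i \<in> I)"
  by (simp add: cargmax_def)

lemmas counted_values = fst_cbind fst_Let fst_cinner fst_csigned fst_flop fst_creturn fst_cvec
  fst_cpositive fst_cargmin fst_cargmax if_distrib[of fst]

lemma fst_quad_iter:
  "fst (quad_iter A b R \<epsilon> (x, wt, g)) =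
    (let key = (\<chi> k. if fst k then g $ snd k else - (g $ snd k));
         u = arg_min (($) key) (\<lambda>k. k \<in> UNIV);
         S = {k. 0 < wt $ k};
         w = arg_max (($) key) (\<lambda>k. k \<in> S);
         gx = g \<bullet> x; gu = R * key $ u; gw = R * key $ w; gapFW = gx - gu; gapA = gw - gx;
         stop = gapFW \<le> \<epsilon> in
     if stop then ((x, wt, g), True)
     else let Ax = (\<chi> i. g $ i - b $ i); fw = gapA \<le> gapFW;
         k = (if fw then u else w); gap = (if fw then gapFW else gapA);
         r = (if fst k then R else - R);
         v = (\<chi> i. if i = snd k then r else 0);
         Av = (\<chi> i. r * A $ i $ snd k);
         d = (\<chi> i. if fw then v $ i - x $ i else x $ i - v $ i);
         Ad = (\<chi> i. if fw then Av $ i - Ax $ i else Ax $ i - Av $ i);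
         \<gamma>max = (if fw then 1 else let c = 1 - wt $ w in wt $ w / c);
         dAd = d \<bullet> Ad; curved = 0 < dAd;
         \<gamma> = (if curved then let c = gap / dAd; small = c \<le> \<gamma>max in if small then c else \<gamma>max
              else \<gamma>max);
         x' = (\<chi> i. let y = \<gamma> * d $ i in x $ i + y);
         g' = (\<chi> i. let y = \<gamma> * Ad $ i in g $ i + y);
         scale = (if fw then 1 - \<gamma> else 1 + \<gamma>);
         scaled = (\<chi> l. scale * wt $ l);
         new = (if fw then scaled $ k + \<gamma> else scaled $ k - \<gamma>)
       in ((x', \<chi> l. if l = k then new else scaled $ l, g'), False))"
  unfolding quad_iter_def prod.case counted_values by (rule refl)

section \<open>Operation counts\<close>

lemma snd_cbind_le: "snd m \<le> p \<Longrightarrow> (\<And>y. snd (k y) \<le> q) \<Longrightarrow> snd (cbind m k) \<le> p + q"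
  by (simp add: cbind_def add_mono)

lemma snd_Let_le: "(\<And>y. snd (F y) \<le> q) \<Longrightarrow> snd (Let t F) \<le> q"
  by simp

lemma snd_if_le:
  fixes m :: "'a counted"
  shows "snd m \<le> p \<Longrightarrow> snd k \<le> q \<Longrightarrow> snd (if c then m else k) \<le> max p q"
  by (simp add: max.coboundedI1 max.coboundedI2)

lemma snd_flop_le: "snd (flop a) \<le> 1"
  by (simp add: flop_def)

lemma snd_creturn_le: "snd (creturn a) \<le> 0"
  by (simp add: creturn_def)

lemma snd_csigned_le: "snd (csigned r s) \<le> 1"
  by (simp add: csigned_def creturn_def flop_def)

lemma snd_cvec_le:
  fixes F :: "'i::finite \<Rightarrow> real counted"
  assumes "\<And>i. snd (F i) \<le> p"
  shows "snd (cvec F) \<le> CARD('i) * p"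
  using sum_bounded_above[of UNIV "\<lambda>i. snd (F i)" p] assms by (simp add: cvec_def)

lemma snd_cinner_le: "snd (cinner x (y :: real^'n)) \<le> 2 * CARD('n)"
  by (simp add: cinner_def csum_def flop_def)

lemma snd_cpositive_le: "snd (cpositive (v :: real^'i)) \<le> CARD('i)"
  by (simp add: cpositive_def)

lemma snd_cargmin_le: "snd (cargmin (v :: real^'i) I) \<le> CARD('i)"
  by (simp add: cargmin_def card_mono)

lemma snd_cargmax_le: "snd (cargmax (v :: real^'i) I) \<le> CARD('i)"
  by (simp add: cargmax_def card_mono)

lemmas counted_costs = snd_cbind_le snd_Let_le snd_if_le snd_flop_le snd_creturn_le snd_csigned_le
  snd_cvec_le snd_cinner_le snd_cpositive_le snd_cargmin_le snd_cargmax_le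

lemma card_bool_prod: "CARD(bool \<times> 'n::finite) = 2 * CARD('n)"
  by simp

text \<open>\<open>order_trans\<close> leaves the intermediate bound schematic and the cost rules
  build it up along the program: \<open>22 * CARD('n) + 14\<close>, with \<open>14\<close> absorbed
  by \<open>1 \<le> CARD('n)\<close>.\<close>

lemma snd_quad_iter_le:
  fixes A :: "real^'n^'n"
  shows "snd (quad_iter A b R \<epsilon> (x, wt, g)) \<le> 36 * CARD('n)"
proof -
  have "1 \<le> CARD('n)" by (simp add: Suc_le_eq)
  then show ?thesis
    unfolding quad_iter_def prod.case
    by - (rule order_trans, (rule counted_costs)+,
        simp only: card_bool_prod max_nat.left_neutral max_nat.right_neutral, simp)
qed

lemma snd_quad_init_le:
  fixes A :: "real^'n^'n"
  shows "snd (quad_init A b R k) \<le> 3 * CARD('n)"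
proof -
  have "1 \<le> CARD('n)" by (simp add: Suc_le_eq)
  then show ?thesis
    unfolding quad_init_def
    by - (rule order_trans, (rule counted_costs)+, simp)
qed

section \<open>Exact line search and gradient of a quadratic\<close>

lemma arg_min_finite:
  fixes h :: "'a \<Rightarrow> 'b::linorder"
  assumes "finite S" and "S \<noteq> {}"
  shows "is_arg_min h (\<lambda>x. x \<in> S) (arg_min h (\<lambda>x. x \<in> S))"
  unfolding arg_min_def using ex_is_arg_min_if_finite[OF assms] by (rule someI_ex)

lemma arg_max_finite:
  fixes h :: "'a \<Rightarrow> 'b::linorder"
  assumes "finite S" and "S \<noteq> {}"
  shows "is_arg_max h (\<lambda>x. x \<in> S) (arg_max h (\<lambda>x. x \<in> S))"
  unfolding arg_max_def
proof (rule someI_ex)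
  have "Max (h ` S) \<in> h ` S" using assms by simp
  then obtain y where "y \<in> S" "h y = Max (h ` S)" by auto
  then show "\<exists>y. is_arg_max h (\<lambda>x. x \<in> S) y"
    using assms by (auto simp: is_arg_max_linorder intro!: exI[of _ y])
qed

text \<open>Along the direction the objective is a parabola or a descending line: the minimum is at
  the apex \<open>gap / q\<close> if that lies within the cap, and at the cap otherwise.\<close>

lemma quadratic_line_search:
  fixes gap q m :: real
  assumes f: "\<And>c. f (x + c *\<^sub>R d) = a - c * gap + c\<^sup>2 / 2 * q"
    and gap: "0 \<le> gap" and q: "0 \<le> q" and m: "0 \<le> m"
  shows "line_search f x d m (if 0 < q then if gap / q \<le> m then gap / q else m else m)"
proof -
  consider "0 < q" "gap / q \<le> m" | "0 < q" "m < gap / q" | "q = 0" using q by linarith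
  then show ?thesis
  proof cases
    case 1
    have "a - gap / q * gap + (gap / q)\<^sup>2 / 2 * q \<le> a - c * gap + c\<^sup>2 / 2 * q" for c
    proof -
      have "(a - c * gap + c\<^sup>2 / 2 * q) - (a - gap / q * gap + (gap / q)\<^sup>2 / 2 * q)
          = q / 2 * (c - gap / q)\<^sup>2"
        using 1 by (simp add: field_simps power2_eq_square)
      moreover have "0 \<le> q / 2 * (c - gap / q)\<^sup>2" using q by simp
      ultimately show ?thesis by linarith
    qed
    with 1 gap show ?thesis by (simp add: line_search_def is_arg_min_linorder f)
  next
    case 2
    have "a - m * gap + m\<^sup>2 / 2 * q \<le> a - c * gap + c\<^sup>2 / 2 * q" if "0 \<le> c" "c \<le> m" for c
    proof -
      have "q * (m + c) \<le> q * (2 * m)" using q that by (intro mult_left_mono) auto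
      moreover have "q * m \<le> gap" using 2 by (simp add: field_simps)
      \<comment> \<open>This product is the difference of the values at \<open>c\<close> and at
        \<open>m\<close>.\<close>
      ultimately have "0 \<le> (m - c) * (gap - q * (m + c) / 2)"
        using that by (intro mult_nonneg_nonneg) auto
      also have "\<dots> = (a - c * gap + c\<^sup>2 / 2 * q) - (a - m * gap + m\<^sup>2 / 2 * q)"
        by (simp add: field_simps power2_eq_square)
      finally show ?thesis by simp
    qed
    with 2 m show ?thesis by (simp add: line_search_def is_arg_min_linorder f)
  next
    case 3
    with m gap show ?thesis
      by (simp add: line_search_def is_arg_min_linorder f mult_right_mono)
  qed
qed

lemma inner_matrix_symmetric:
  fixes A :: "real^'n^'n"
  assumes "transpose A = A"
  shows "x \<bullet> (A *v y) = y \<bullet> (A *v x)"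
  using dot_lmul_matrix[of x A y] assms
  by (metis inner_commute matrix_transpose_mul transpose_matrix_vector)

lemma quadratic_along_line:
  fixes A :: "real^'n^'n"
  assumes "transpose A = A"
  shows "1/2 * ((x + c *\<^sub>R d) \<bullet> (A *v (x + c *\<^sub>R d))) + b \<bullet> (x + c *\<^sub>R d)
    = (1/2 * (x \<bullet> (A *v x)) + b \<bullet> x) - c * (- ((A *v x + b) \<bullet> d)) + c\<^sup>2 / 2 * (d \<bullet> (A *v d))"
  using inner_matrix_symmetric[OF assms, of x d]
  by (simp add: matrix_vector_right_distrib matrix_vector_mult_scaleR inner_add_left inner_add_right
      inner_commute[of "A *v x" d] algebra_simps power2_eq_square)

lemma quadratic_gradient:
  fixes A :: "real^'n^'n"
  assumes "transpose A = A"
  shows "GDERIV (\<lambda>x. 1/2 * (x \<bullet> (A *v x)) + b \<bullet> x) x :> A *v x + b"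
proof -
  have lin: "((\<lambda>x. A *v x) has_derivative (\<lambda>h. A *v h)) (at x)"
    by (rule bounded_linear_imp_has_derivative) (rule matrix_vector_mul_bounded_linear)
  have "((\<lambda>x. 1/2 * (x \<bullet> (A *v x)) + b \<bullet> x) has_derivative
      (\<lambda>h. 1/2 * (x \<bullet> (A *v h) + h \<bullet> (A *v x)) + b \<bullet> h)) (at x)"
    by (rule has_derivative_add[OF has_derivative_mult_right[OF has_derivative_inner[OF
              has_derivative_ident lin]] has_derivative_inner_right[OF has_derivative_ident]])
  moreover have "(\<lambda>h. 1/2 * (x \<bullet> (A *v h) + h \<bullet> (A *v x)) + b \<bullet> h) = (\<lambda>h. h \<bullet> (A *v x + b))"
    by (rule ext) (simp add: inner_matrix_symmetric[OF assms, of x] inner_add_right inner_commute[of b])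
  ultimately show ?thesis by (simp add: gderiv_def)
qed

text \<open>Serves to identify the given \<open>df\<close> with \<open>A *v x + b\<close>.\<close>

lemma GDERIV_unique:
  assumes "GDERIV f x :> a" and "GDERIV f x :> b"
  shows "a = b"
proof -
  have "(\<lambda>h. h \<bullet> a) = (\<lambda>h. h \<bullet> b)"
    using assms unfolding gderiv_def by (rule has_derivative_unique)
  then have "\<forall>h. h \<bullet> a = h \<bullet> b" by (simp add: fun_eq_iff)
  then show ?thesis by (simp add: vector_eq_ldot)
qed

section \<open>Simulation of the abstract algorithm\<close>

lemma abstract_state_vertex:
  assumes "0 < R"
  shows "snd (abstract_state R (x, wt, g)) (vertex R k) = wt $ k"
  using assms by (simp add: abstract_state_def vertex_eq_iff)

lemma abstract_state_outside:
  "v \<notin> vertices R \<Longrightarrow> snd (abstract_state R (x, wt, g)) v = 0"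
  by (auto simp: abstract_state_def vertices_def intro!: sum.neutral)

lemma fst_abstract_state [simp]: "fst (abstract_state R (x, wt, g)) = x"
  by (simp add: abstract_state_def)

lemma abstract_state_eqI:
  assumes "0 < R"
    and "\<And>k. wt' (vertex R k) = wt $ k"
    and "\<And>v. v \<notin> vertices R \<Longrightarrow> wt' v = 0"
  shows "abstract_state R (x, wt, g) = (x, wt')"
proof (rule prod_eqI)
  show "snd (abstract_state R (x, wt, g)) = snd (x, wt')"
  proof
    fix v
    show "snd (abstract_state R (x, wt, g)) v = snd (x, wt') v"
      using assms abstract_state_vertex[OF assms(1)] abstract_state_outside[of v R]
      by (cases "v \<in> vertices R") (auto simp: vertices_def)
  qed
qed simp

lemma vertex_eq: "vertex R k = (\<chi> i. if i = snd k then (if fst k then R else - R) else 0)"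
  by (auto simp: vertex_def vec_eq_iff axis_def)

lemma matrix_vertex:
  "A *v vertex R k = (\<chi> i. (if fst k then R else - R) * A $ i $ snd k)"
  by (simp add: vec_eq_iff vertex_eq matrix_vector_mult_def if_distrib cong: if_cong)

text \<open>\<open>R * key\<close> lists the inner products of the gradient with the vertices, so
  the program's choices of \<open>u\<close> and \<open>w\<close> are legal. The identity
  \<open>g = A *v x + b\<close> makes the gaps and the line search exact and is preserved by the
  update.\<close>

lemma quad_iter_simulates:
  fixes A :: "real^'n^'n"
  assumes sym: "transpose A = A" and psd: "\<And>x. 0 \<le> x \<bullet> (A *v x)" and R: "0 < R" and \<epsilon>: "0 < \<epsilon>"
    and valid: "valid R (abstract_state R (x, wt, g))" and g: "g = A *v x + b"
  defines "f \<equiv> \<lambda>x. 1/2 * (x \<bullet> (A *v x)) + b \<bullet> x" and "df \<equiv> \<lambda>x. A *v x + b"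
    and "st \<equiv> abstract_state R (x, wt, g)"
  shows "if afw_stop df R \<epsilon> st then fst (quad_iter A b R \<epsilon> (x, wt, g)) = ((x, wt, g), True)
    else \<exists>x' wt'. fst (quad_iter A b R \<epsilon> (x, wt, g)) = ((x', wt', A *v x' + b), False) \<and>
      afw_step f df R st (abstract_state R (x', wt', A *v x' + b))"
proof -
  define key where "key = (\<chi> k::bool \<times> 'n. if fst k then g $ snd k else - (g $ snd k))"
  define u where "u = arg_min (($) key) (\<lambda>k. k \<in> UNIV)"
  define w where "w = arg_max (($) key) (\<lambda>k. k \<in> {k. 0 < wt $ k})"
  define gapFW where "gapFW = g \<bullet> x - R * key $ u"
  define gapA where "gapA = R * key $ w - g \<bullet> x"
  define fw where "fw = (gapA \<le> gapFW)"
  define k where "k = (if fw then u else w)"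
  define gap where "gap = (if fw then gapFW else gapA)"
  define v where "v = (\<chi> i. if i = snd k then if fst k then R else - R else 0)"
  define Av where "Av = (\<chi> i. (if fst k then R else - R) * A $ i $ snd k)"
  define d where "d = (\<chi> i. if fw then v $ i - x $ i else x $ i - v $ i)"
  define Ad where "Ad = (\<chi> i. if fw then Av $ i - (\<chi> i. g $ i - b $ i) $ i else (\<chi> i. g $ i - b $ i) $ i - Av $ i)"
  define m where "m = (if fw then 1 else wt $ w / (1 - wt $ w))"
  define \<gamma> where "\<gamma> = (if 0 < d \<bullet> Ad then if gap / (d \<bullet> Ad) \<le> m then gap / (d \<bullet> Ad) else m else m)"
  define scaled where "scaled = (\<chi> l. (if fw then 1 - \<gamma> else 1 + \<gamma>) * wt $ l)"
  define wt' where "wt' = (\<chi> l. if l = k then if fw then scaled $ k + \<gamma> else scaled $ k - \<gamma> else scaled $ l)"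
  have iter: "fst (quad_iter A b R \<epsilon> (x, wt, g)) = (if gapFW \<le> \<epsilon> then ((x, wt, g), True)
      else (((\<chi> i. x $ i + \<gamma> * d $ i), wt', (\<chi> i. g $ i + \<gamma> * Ad $ i)), False))"
    unfolding fst_quad_iter Let_def wt'_def scaled_def \<gamma>_def m_def Ad_def d_def Av_def v_def gap_def k_def
      fw_def gapA_def gapFW_def w_def u_def key_def
    by (rule refl)
  have key: "df x \<bullet> vertex R l = R * key $ l" for l
    by (simp add: inner_vertex df_def g key_def right_diff_distrib distrib_left)
  have wt_st: "snd st (vertex R l) = wt $ l" for l
    unfolding st_def by (rule abstract_state_vertex[OF R])
  have fst_st: "fst st = x" by (simp add: st_def)
  have u: "lmo df R x (vertex R u)"
    using arg_min_finite[of UNIV "($) key"] R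
    by (auto simp: lmo_def is_arg_min_linorder vertices_def key u_def)
  have active_iff: "vertex R l \<in> active R (snd st) \<longleftrightarrow> 0 < wt $ l" for l
    by (simp add: active_def wt_st vertices_def)
  obtain l where "0 < wt $ l"
    using active_nonempty[OF valid] active_iff by (auto simp: active_def vertices_def st_def)
  then have w_max: "is_arg_max (($) key) (\<lambda>l. l \<in> {l. 0 < wt $ l}) w"
    unfolding w_def by (intro arg_max_finite) (simp, blast)
  then have w_pos: "0 < wt $ w" by (simp add: is_arg_max_linorder)
  have w: "away_vertex df R st (vertex R w)"
    using w_max R active_iff
    by (auto simp: away_vertex_def is_arg_max_linorder fst_st key) (auto simp: active_def vertices_def key)
  have gapFW: "gapFW = (- df x) \<bullet> (vertex R u - x)"
    by (simp add: inner_diff_right key gapFW_def) (simp add: g df_def)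
  have gapA: "gapA = (- df x) \<bullet> (x - vertex R w)"
    by (simp add: inner_diff_right key gapA_def) (simp add: g df_def)
  have stop: "afw_stop df R \<epsilon> st \<longleftrightarrow> gapFW \<le> \<epsilon>"
  proof -
    \<comment> \<open>All minimizing vertices give the same gap, so testing the computed one decides
      \<open>afw_stop\<close>.\<close>
    have "(- df x) \<bullet> (u' - x) = gapFW" if "lmo df R x u'" for u'
    proof -
      have "df x \<bullet> u' \<le> df x \<bullet> vertex R u" "df x \<bullet> vertex R u \<le> df x \<bullet> u'"
        using that u by (simp_all add: lmo_def is_arg_min_linorder)
      then show ?thesis by (simp add: gapFW inner_diff_right)
    qed
    then show ?thesis unfolding afw_stop_def fst_st using u by metis
  qed
  show ?thesis
  proof (cases "gapFW \<le> \<epsilon>")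
    case True
    then show ?thesis by (simp add: stop iter)
  next
    case False
    have v: "v = vertex R k" by (simp add: v_def vertex_eq)
    have Av: "Av = A *v v" by (simp add: Av_def v matrix_vertex)
    have d: "d = (if fw then v - x else x - v)" by (simp add: d_def vec_eq_iff)
    \<comment> \<open>\<open>g - b\<close> is \<open>A *v x\<close>, and \<open>Av\<close> is a
      scaled column of \<open>A\<close>; no full matrix product is formed.\<close>
    have Ad: "Ad = A *v d"
      by (simp add: Ad_def Av d g vec_eq_iff matrix_vector_mult_diff_distrib)
    define x' where "x' = x + \<gamma> *\<^sub>R d"
    have x': "(\<chi> i. x $ i + \<gamma> * d $ i) = x'" by (simp add: x'_def vec_eq_iff)
    have g': "(\<chi> i. g $ i + \<gamma> * Ad $ i) = A *v x' + b"
      by (simp add: x'_def g Ad vec_eq_iff matrix_vector_right_distrib matrix_vector_mult_scaleR)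
    have gap: "gap = - (df x \<bullet> d)"
      by (simp add: gap_def d v k_def gapFW gapA)
    have gap_pos: "0 < gap" using False \<epsilon> by (auto simp: gap_def fw_def)
    have m: "0 \<le> m"
    proof (cases fw)
      case False
      then have "x \<noteq> vertex R w" using gap_pos by (auto simp: gap d v k_def)
      then have "wt $ w < 1"
        using weight_less_1[OF valid, of "vertex R w"] wt_st by (simp add: st_def vertices_def)
      with w_pos show ?thesis by (simp add: m_def)
    qed (simp add: m_def)
    have ls: "line_search f x d m \<gamma>"
      unfolding \<gamma>_def
    proof (rule quadratic_line_search)
      show "f (x + c *\<^sub>R d) = f x - c * gap + c\<^sup>2 / 2 * (d \<bullet> Ad)" for c
        unfolding f_def gap df_def Ad by (rule quadratic_along_line[OF sym])
    qed (use gap_pos psd m Ad in auto)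
    have abs': "abstract_state R (x', wt', A *v x' + b)
        = (x', \<lambda>y. if fw then (1 - \<gamma>) * snd st y + (if y = v then \<gamma> else 0)
             else (1 + \<gamma>) * snd st y - (if y = v then \<gamma> else 0))"
    proof (rule abstract_state_eqI[OF R])
      show "(if fw then (1 - \<gamma>) * snd st (vertex R l) + (if vertex R l = v then \<gamma> else 0)
          else (1 + \<gamma>) * snd st (vertex R l) - (if vertex R l = v then \<gamma> else 0)) = wt' $ l" for l
        using R by (auto simp: wt_st wt'_def scaled_def v vertex_eq_iff)
      show "(if fw then (1 - \<gamma>) * snd st y + (if y = v then \<gamma> else 0)
          else (1 + \<gamma>) * snd st y - (if y = v then \<gamma> else 0)) = 0" if "y \<notin> vertices R" for y
        using that by (auto simp: st_def abstract_state_outside v vertices_def)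
    qed
    have "afw_step f df R st (abstract_state R (x', wt', A *v x' + b))"
      unfolding afw_step_def Let_def fst_st
    proof (intro exI conjI)
      show "lmo df R x (vertex R u)" by (rule u)
      show "away_vertex df R st (vertex R w)" by (rule w)
      show "if (- df x) \<bullet> (x - vertex R w) \<le> (- df x) \<bullet> (vertex R u - x)
        then line_search f x (vertex R u - x) 1 \<gamma> \<and>
             abstract_state R (x', wt', A *v x' + b) = (x + \<gamma> *\<^sub>R (vertex R u - x),
               \<lambda>y. (1 - \<gamma>) * snd st y + (if y = vertex R u then \<gamma> else 0))
        else line_search f x (x - vertex R w) (snd st (vertex R w) / (1 - snd st (vertex R w))) \<gamma> \<and>
             abstract_state R (x', wt', A *v x' + b) = (x + \<gamma> *\<^sub>R (x - vertex R w),
               \<lambda>y. (1 + \<gamma>) * snd st y - (if y = vertex R w then \<gamma> else 0))"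
        using ls unfolding abs' gapFW[symmetric] gapA[symmetric] fw_def[symmetric] wt_st
        by (auto simp: x'_def d v k_def m_def)
    qed
    then show ?thesis using False by (auto simp: stop iter x' g')
  qed
qed

lemma quad_init_value:
  fixes A :: "real^'n^'n"
  shows "fst (quad_init A b R k) = ((vertex R k, \<chi> l. if l = k then 1 else 0, A *v vertex R k + b), False)"
  unfolding quad_init_def counted_values Let_def by (simp add: vertex_eq matrix_vertex[unfolded vertex_eq] vec_eq_iff)

lemma abstract_init:
  assumes "0 < R"
  shows "abstract_state R (x, \<chi> l. if l = k then 1 else 0, g) = (x, \<lambda>v. if v = vertex R k then 1 else 0)"
  using assms by (intro abstract_state_eqI) (auto simp: vertex_eq_iff vertices_def)

lemma quad_loop_body_cases:
  "quad_loop_body A b R \<epsilon> m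
    = (fst (quad_iter A b R \<epsilon> (fst (fst m))), snd m + snd (quad_iter A b R \<epsilon> (fst (fst m))))"
  by (simp add: quad_loop_body_def cbind_def split: prod.splits)

section \<open>Correctness and cost of the program\<close>

context smooth_convex_on_l1ball
begin

text \<open>Induction over loop iterations carries validity, the form of the gradient and the cost.
  A test that succeeds at state \<open>T\<close> ends the loop after at most \<open>T + 1\<close>
  iterations, whence \<open>39 = 3 + 36\<close>.\<close>

lemma quad_afw_correct:
  fixes A :: "real^'n^'n"
  assumes sym: "transpose A = A" and psd: "\<And>x. 0 \<le> x \<bullet> (A *v x)"
    and f: "f = (\<lambda>x. 1/2 * (x \<bullet> (A *v x)) + b \<bullet> x)"
  shows "afw_run f df R \<epsilon> (quad_trace A b R \<epsilon> k)"
    and "afw_stop df R \<epsilon> (quad_trace A b R \<epsilon> k T) \<Longrightarrow>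
      \<exists>x wt g c. quad_afw A b R \<epsilon> k = Some (((x, wt, g), True), c) \<and>
        approx_solution f R \<epsilon> x \<and> c \<le> CARD('n) * (39 + 36 * T)"
proof -
  define \<tau> where "\<tau> = quad_trace A b R \<epsilon> k"
  \<comment> \<open>The loop body is iterated past termination too, to match the infinite
    run.\<close>
  define M where "M = (\<lambda>t. (quad_loop_body A b R \<epsilon> ^^ t) (quad_init A b R k))"
  have df: "df = (\<lambda>x. A *v x + b)"
    using GDERIV_unique[OF deriv quadratic_gradient[OF sym, of b, folded f]] by blast
  have \<tau>: "\<tau> t = abstract_state R (fst (fst (M t)))" for t
    by (simp add: \<tau>_def quad_trace_def M_def)
  have M_Suc: "M (Suc t) = quad_loop_body A b R \<epsilon> (M t)" for t by (simp add: M_def)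
  have \<tau>_0: "\<tau> 0 = (vertex R k, \<lambda>v. if v = vertex R k then 1 else 0)"
    by (simp add: \<tau> M_def quad_init_value abstract_init[OF R_pos])
  have inv: "valid R (\<tau> t) \<and> (\<exists>x wt. fst (fst (M t)) = (x, wt, A *v x + b)) \<and>
      snd (M t) \<le> CARD('n) * (3 + 36 * t)" for t
  proof (induction t)
    case 0
    have "valid R (\<tau> 0)" unfolding \<tau>_0 by (rule valid_init) (simp add: vertices_def)
    then show ?case using snd_quad_init_le[of A b R k] by (simp add: M_def quad_init_value mult.commute)
  next
    case (Suc t)
    then obtain x wt where M: "fst (fst (M t)) = (x, wt, A *v x + b)" and valid: "valid R (\<tau> t)"
      and c: "snd (M t) \<le> CARD('n) * (3 + 36 * t)" by blast
    have sim: "if afw_stop df R \<epsilon> (\<tau> t) then fst (quad_iter A b R \<epsilon> (x, wt, A *v x + b)) = ((x, wt, A *v x + b), True)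
      else \<exists>x' wt'. fst (quad_iter A b R \<epsilon> (x, wt, A *v x + b)) = ((x', wt', A *v x' + b), False) \<and>
        afw_step f df R (\<tau> t) (abstract_state R (x', wt', A *v x' + b))"
      using quad_iter_simulates[OF sym psd R_pos \<epsilon>_pos valid[unfolded \<tau> M] refl, folded df f]
      by (simp only: \<tau> M)
    have "snd (M (Suc t)) \<le> CARD('n) * (3 + 36 * Suc t)"
      using c snd_quad_iter_le[of A b R \<epsilon> x wt "A *v x + b"]
      by (simp add: M_Suc quad_loop_body_cases M algebra_simps)
    moreover have "valid R (\<tau> (Suc t)) \<and> (\<exists>x wt. fst (fst (M (Suc t))) = (x, wt, A *v x + b))"
    proof (cases "afw_stop df R \<epsilon> (\<tau> t)")
      case True
      then have "fst (fst (M (Suc t))) = fst (fst (M t))"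
        using sim by (simp add: M_Suc quad_loop_body_cases M)
      then show ?thesis using valid M by (simp add: \<tau>)
    next
      case False
      then obtain x' wt' where "fst (fst (M (Suc t))) = (x', wt', A *v x' + b)"
        and "afw_step f df R (\<tau> t) (abstract_state R (x', wt', A *v x' + b))"
        using sim by (auto simp: M_Suc quad_loop_body_cases M)
      then show ?thesis using afw_step_properties(1)[OF valid False] by (simp add: \<tau>)
    qed
    ultimately show ?case by blast
  qed
  \<comment> \<open>The flag after iteration \<open>Suc t\<close> reports the test on the state
    before it.\<close>
  have sim: "(snd (fst (M (Suc t))) \<longleftrightarrow> afw_stop df R \<epsilon> (\<tau> t)) \<and>
      (if afw_stop df R \<epsilon> (\<tau> t) then \<tau> (Suc t) = \<tau> t else afw_step f df R (\<tau> t) (\<tau> (Suc t)))" for t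
  proof -
    obtain x wt where M: "fst (fst (M t)) = (x, wt, A *v x + b)" and valid: "valid R (\<tau> t)"
      using inv by blast
    show ?thesis
      using quad_iter_simulates[OF sym psd R_pos \<epsilon>_pos valid[unfolded \<tau> M] refl, folded df f]
      by (auto simp: \<tau> M M_Suc quad_loop_body_cases split: if_splits)
  qed
  show "afw_run f df R \<epsilon> (quad_trace A b R \<epsilon> k)"
    unfolding afw_run_def \<tau>_def[symmetric] using sim \<tau>_0 by (auto simp: vertices_def)
  assume "afw_stop df R \<epsilon> (quad_trace A b R \<epsilon> k T)"
  then have "snd (fst (M (Suc T)))" using sim by (simp add: \<tau>_def)
  \<comment> \<open>\<open>while_option\<close> returns the iterate at this least index. The
    iteration that raises the flag does not change the state.\<close>
  define L where "L = (LEAST t. snd (fst (M t)))"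
  have L: "snd (fst (M L))" "L \<le> Suc T"
    unfolding L_def using \<open>snd (fst (M (Suc T)))\<close> by (rule LeastI, rule Least_le)
  have "\<not> snd (fst (M 0))" by (simp add: M_def quad_init_value)
  with L obtain T' where T': "L = Suc T'" by (cases L) auto
  then have stop: "afw_stop df R \<epsilon> (\<tau> T')" using L sim by simp
  then have "\<tau> L = \<tau> T'" using sim T' by simp
  then have "approx_solution f R \<epsilon> (fst (\<tau> L))" using stop_imp_approx inv stop by simp
  moreover obtain x wt where x: "fst (fst (M L)) = (x, wt, A *v x + b)" using inv by blast
  ultimately have approx: "approx_solution f R \<epsilon> x" by (simp add: \<tau>)
  have "quad_afw A b R \<epsilon> k = Some (M L)"
  proof -
    have "\<exists>t. snd (fst (M t))" using \<open>snd (fst (M (Suc T)))\<close> by blast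
    then show ?thesis by (simp add: quad_afw_def while_option_def case_prod_beta L_def M_def)
  qed
  also have "M L = (((x, wt, A *v x + b), True), snd (M L))"
    using x L by (simp add: prod_eq_iff)
  finally have "quad_afw A b R \<epsilon> k = Some (((x, wt, A *v x + b), True), snd (M L))" .
  moreover have "snd (M L) \<le> CARD('n) * (39 + 36 * T)"
  proof -
    have "snd (M L) \<le> CARD('n) * (3 + 36 * L)" using inv by blast
    also have "\<dots> \<le> CARD('n) * (39 + 36 * T)" using L(2) by (intro mult_left_mono) auto
    finally show ?thesis .
  qed
  ultimately show "\<exists>x wt g c. quad_afw A b R \<epsilon> k = Some (((x, wt, g), True), c) \<and>
        approx_solution f R \<epsilon> x \<and> c \<le> CARD('n) * (39 + 36 * T)"
    using approx by blast
qed

end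

theorem theorem2:
  fixes f :: "real^'n \<Rightarrow> real" and df :: "real^'n \<Rightarrow> real^'n"
    and R \<beta>\<^sub>1 \<alpha>\<^sub>2 \<epsilon> :: real and s :: nat
  assumes "convex_on UNIV f"
    and "\<And>x. GDERIV f x :> df x"
    and "continuous_on UNIV df"
    and "R > 0"
    and "\<beta>\<^sub>1 > 0"
    and "\<And>x y. infnorm (df x - df y) \<le> \<beta>\<^sub>1 * l1norm (x - y)"
    and "\<alpha>\<^sub>2 > 0"
    and "quadratic_growth f R \<alpha>\<^sub>2"
    and "\<And>x. x \<in> minimizers f R \<Longrightarrow> nnz x \<le> s \<and> l1norm x = R"
    and "\<epsilon> > 0"
  shows "let N = max 1 (\<beta>\<^sub>1 * real s * max 1 (R\<^sup>2) / \<alpha>\<^sub>2 * ln (\<beta>\<^sub>1 * R\<^sup>2 / \<epsilon>)) in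
     (\<forall>\<sigma>. afw_run f df R \<epsilon> \<sigma> \<longrightarrow>
        (\<exists>T. real T \<le> 10^4 * N \<and> afw_stop df R \<epsilon> (\<sigma> T) \<and> approx_solution f R \<epsilon> (fst (\<sigma> T)))) \<and>
     (\<forall>A b k. transpose A = A \<and> (\<forall>x. 0 \<le> x \<bullet> (A *v x)) \<and>
          f = (\<lambda>x. 1/2 * (x \<bullet> (A *v x)) + b \<bullet> x) \<longrightarrow>
        afw_run f df R \<epsilon> (quad_trace A b R \<epsilon> k) \<and>
        (\<exists>x wt g c. quad_afw A b R \<epsilon> k = Some (((x, wt, g), True), c) \<and>
           approx_solution f R \<epsilon> x \<and> real c \<le> 10^6 * real CARD('n) * N))"
proof -
  interpret sparse_optimum f df R \<beta>\<^sub>1 \<epsilon> \<alpha>\<^sub>2 s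
    using assms by unfold_locales
  define N where "N = max 1 (\<beta>\<^sub>1 * real s * max 1 (R\<^sup>2) / \<alpha>\<^sub>2 * ln (\<beta>\<^sub>1 * R\<^sup>2 / \<epsilon>))"
  have stops: "\<exists>T. real T \<le> 10^4 * N \<and> afw_stop df R \<epsilon> (\<sigma> T) \<and> approx_solution f R \<epsilon> (fst (\<sigma> T))"
    if "afw_run f df R \<epsilon> \<sigma>" for \<sigma>
    unfolding N_def by (rule afw_stops[OF that])
  have quad: "afw_run f df R \<epsilon> (quad_trace A b R \<epsilon> k) \<and>
        (\<exists>x wt g c. quad_afw A b R \<epsilon> k = Some (((x, wt, g), True), c) \<and>
           approx_solution f R \<epsilon> x \<and> real c \<le> 10^6 * real CARD('n) * N)"
    if A: "transpose A = A" "\<And>x. 0 \<le> x \<bullet> (A *v x)" "f = (\<lambda>x. 1/2 * (x \<bullet> (A *v x)) + b \<bullet> x)" for A b k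
  proof -
    have run: "afw_run f df R \<epsilon> (quad_trace A b R \<epsilon> k)" by (rule quad_afw_correct(1)[OF A])
    then obtain T where T: "real T \<le> 10^4 * N" "afw_stop df R \<epsilon> (quad_trace A b R \<epsilon> k T)"
      using stops by blast
    obtain x wt g c where result: "quad_afw A b R \<epsilon> k = Some (((x, wt, g), True), c)"
        "approx_solution f R \<epsilon> x" and c: "c \<le> CARD('n) * (39 + 36 * T)"
      using quad_afw_correct(2)[OF A T(2)] by blast
    have "real c \<le> real CARD('n) * (39 + 36 * real T)"
      using of_nat_mono[OF c, where ?'a = real] by simp
    also have "\<dots> \<le> real CARD('n) * (10^6 * N)"
    proof (rule mult_left_mono)
      \<comment> \<open>\<open>39 + 36 * 10 ^ 4 * N\<close> is at most
        \<open>360039 * N\<close>.\<close>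
      have "1 \<le> N" by (simp add: N_def)
      with T(1) show "39 + 36 * real T \<le> 10^6 * N" by simp
    qed simp
    finally have "real c \<le> 10^6 * real CARD('n) * N" by (simp only: mult_ac)
    with run result show ?thesis by (intro conjI exI)
  qed
  show ?thesis
    unfolding Let_def N_def[symmetric]
  proof (intro conjI allI impI)
    show "\<exists>T. real T \<le> 10^4 * N \<and> afw_stop df R \<epsilon> (\<sigma> T) \<and> approx_solution f R \<epsilon> (fst (\<sigma> T))"
      if "afw_run f df R \<epsilon> \<sigma>" for \<sigma> by (rule stops[OF that])
  next
    fix A b k
    assume "transpose A = A \<and> (\<forall>x. 0 \<le> x \<bullet> (A *v x)) \<and> f = (\<lambda>x. 1/2 * (x \<bullet> (A *v x)) + b \<bullet> x)"
    then have A: "transpose A = A" "\<And>x. 0 \<le> x \<bullet> (A *v x)" "f = (\<lambda>x. 1/2 * (x \<bullet> (A *v x)) + b \<bullet> x)"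
      by simp_all
    show "afw_run f df R \<epsilon> (quad_trace A b R \<epsilon> k)"
      and "\<exists>x wt g c. quad_afw A b R \<epsilon> k = Some (((x, wt, g), True), c) \<and>
           approx_solution f R \<epsilon> x \<and> real c \<le> 10^6 * real CARD('n) * N"
      using quad[OF A] by (rule conjunct1, rule conjunct2)
  qed
qed

end
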